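(* Let $\mathbb{O}$ be a split octonion algebra over a field $F$, written as $\mathbb{O}=\mathbb{H}+\mathbb{H}w$ with $\mathbb{H}=F^{2\times 2}$ and $w^2=1$, and let $p_0=\begin{pmatrix}1&0\\0&0\end{pmatrix}$, $n_0=\begin{pmatrix}0&1\\0&0\end{pmatrix}\in\mathbb{H}$. Let $A$ be a subalgebra of $\mathbb{O}$ with $1\notin A$. Then $A$ is totally singular (i.e. $N(A)=\{0\}$), and $\dim A\le 4$. Moreover: (a) If $\dim A=1$ then $A=Fa$ with $a\in\mathbb{O}$ such that $N(a)=0$. These subalgebras form two orbits under $\mathrm{Aut}_F(\mathbb{O})$, represented, respectively, by $Fp_0$ and by $Fn_0$. ($F$ and $Fp_0$ are isomorphic as algebras, under an isomorphism mapping $1$ to $p_0\ne 1$.) (b) Totally singular subalgebras of dimension $2$ form three orbits under $\mathrm{Aut}_F(\mathbb{O})$: (i) algebras with a left identity for the multiplication, such as $Fp_0+Fn_0$; (ii) algebras with a right identity for the multiplication, obtained by applying some anti-automorphism (such as $\kappa$) to algebras with left identity; (iii) algebras with trivial multiplication (all products are $0$), such as $(Fp_0+Fn_0)w$. Each of the algebras in orbit (iii) is contained in $1^\perp$, while none of those in orbits (i), (ii) is contained in $1^\perp$. (c) Totally singular subalgebras of dimension $3$ form two orbits under $\mathrm{Aut}_F(\mathbb{O})$, namely: (i) Heisenberg algebras $Fx+Fy+Fn$ with $xy=n=-yx$, obtained as $n\mathbb{O}\cap\mathbb{O}n$ for $n\in\mathbb{O}$ with $n^2=0\ne n$; these are contained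 in $1^\perp$; (ii) algebras of the form $m\mathbb{O}\cap\mathbb{O}n$ where $m,n\in\mathbb{O}$ are linearly independent with $m^2=n^2=mn=nm=0$; none of these is contained in $1^\perp$. (d) Totally singular subalgebras of dimension $4$ form two orbits under $\mathrm{Aut}_F(\mathbb{O})$, namely: (i) $n\mathbb{O}$ for $n\in\mathbb{O}$ with $n^2=0\neq n$; (ii) $\mathbb{O}n$ for $n\in\mathbb{O}$ with $n^2=0\ne n$. In particular, two totally singular subalgebras of $\mathbb{O}$ are isomorphic (as $F$-algebras) if, and only if, they are in the same orbit under $\mathrm{Aut}_F(\mathbb{O})$. The totally singular subalgebras of dimension at most $3$ are associative. The totally singular subalgebras of dimension $4$ are not associative.
   Context: $F$ is an arbitrary field (any characteristic). A composition algebra over $F$ is a (not necessarily associative) $F$-algebra $C$ with neutral element $1$ and a quadratic form $N\colon C\to F$ (norm) with $N(xy)=N(x)N(y)$ whose polar form $(x|y)=N(x+y)-N(x)-N(y)$ is non-degenerate. $F$ is identified with $F1$. An octonion algebra is a composition algebra of dimension $8$; it is split if some non-zero element has norm $0$. The standard involution is $\kappa\colon x\mapsto\bar x=(x|1)1-x$, and the trace is $\mathrm{T}(x)=x+\bar x=(x|1)$. Orthogonality $\perp$ refers to the polar form. A subalgebra is an $F$-linear subspace closed under multiplication (it need not contain $1$). $\mathrm{Aut}_F(\mathbb{O})$ is the group of $F$-linear algebra automorphisms. The split octonion algebra is $\mathbb{O}=\mathbb{H}\oplus\mathbb{H}w$ with $\mathbb{H}=F^{2\times2}$, $\bar a$ the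 adjugate of $a\in\mathbb{H}$, multiplication $(a+xw)(b+yw)=(ab+\bar y x)+(ya+x\bar b)w$ and norm $N(a+xw)=\det a-\det x$. The Heisenberg algebra over $F$ is the $3$-dimensional algebra with basis $x,y,n$ such that $xy=n=-yx$ and all other products of basis elements are $0$. For $a\in\mathbb{O}$: $a\mathbb{O}=\{ax\mid x\in\mathbb{O}\}$, $\mathbb{O}a=\{xa\mid x\in\mathbb{O}\}$. *)

theory Defs
  imports "HOL-Analysis.Analysis"
begin

section \<open>The split octonion algebra\<close>

definition adjugate2 :: "'a::comm_ring_1^2^2 \<Rightarrow> 'a^2^2" where
  "adjugate2 a = vector [vector [a$2$2, - a$1$2], vector [- a$2$1, a$1$1]]"

text \<open>\<open>Oct a x\<close> is the element \<open>a + xw\<close> of the double of the algebra of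
  \<open>2 \<times> 2\<close> matrices. On matrices, \<open>**\<close> is the matrix product; the symbol \<open>*\<close> of type
  \<^typ>\<open>'a^2^2\<close> is the entrywise product and is not used.\<close>

datatype 'a octonion = Oct (oct_fst: "'a^2^2") (oct_snd: "'a^2^2")

instantiation octonion :: (field) ab_group_add
begin
definition "0 = Oct 0 0"
definition "u + v = Oct (oct_fst u + oct_fst v) (oct_snd u + oct_snd v)"
definition "u - v = Oct (oct_fst u - oct_fst v) (oct_snd u - oct_snd v)"
definition "- u = Oct (- oct_fst u) (- oct_snd u)"
instance
  by standard (auto simp: zero_octonion_def plus_octonion_def minus_octonion_def
      uminus_octonion_def intro: octonion.expand)
end

instantiation octonion :: (field) "{one, times}"
begin
definition "1 = Oct (mat 1) 0"
definition "u * v =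
  Oct (oct_fst u ** oct_fst v + adjugate2 (oct_snd v) ** oct_snd u)
      (oct_snd v ** oct_fst u + oct_snd u ** adjugate2 (oct_fst v))"
instance ..
end

definition oct_scale :: "'a::field \<Rightarrow> 'a octonion \<Rightarrow> 'a octonion" where
  "oct_scale c u = Oct (\<chi> i j. c * oct_fst u $ i $ j) (\<chi> i j. c * oct_snd u $ i $ j)"

interpretation oct: vector_space oct_scale
  by standard (auto simp: oct_scale_def plus_octonion_def vec_eq_iff algebra_simps
      intro!: octonion.expand)

definition oct_norm :: "'a::field octonion \<Rightarrow> 'a" where
  "oct_norm u = det (oct_fst u) - det (oct_snd u)"

definition oct_polar :: "'a::field octonion \<Rightarrow> 'a octonion \<Rightarrow> 'a" where
  "oct_polar u v = oct_norm (u + v) - oct_norm u - oct_norm v"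

definition oct_conj :: "'a::field octonion \<Rightarrow> 'a octonion" where
  "oct_conj u = oct_scale (oct_polar u 1) 1 - u"

definition one_perp :: "'a::field octonion set" where
  "one_perp = {u. oct_polar u 1 = 0}"

definition oct_p0 :: "'a::field octonion" where
  "oct_p0 = Oct (vector [vector [1, 0], vector [0, 0]]) 0"

definition oct_n0 :: "'a::field octonion" where
  "oct_n0 = Oct (vector [vector [0, 1], vector [0, 0]]) 0"

definition oct_w :: "'a::field octonion" where
  "oct_w = Oct 0 (mat 1)"


section \<open>The model is a split composition algebra of dimension 8\<close>

lemmas oct_defs = zero_octonion_def plus_octonion_def minus_octonion_def uminus_octonion_def
  one_octonion_def times_octonion_def oct_scale_def oct_norm_def adjugate2_def

lemmas mat2_simps = vec_eq_iff forall_2 sum_2 det_2 matrix_matrix_mult_def mat_def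

lemma oct_mult_bilinear:
  fixes u v w :: "'a::field octonion"
  shows "(u + v) * w = u * w + v * w" "u * (v + w) = u * v + u * w"
    "oct_scale c u * v = oct_scale c (u * v)" "u * oct_scale c v = oct_scale c (u * v)"
  by (auto simp: oct_defs mat2_simps algebra_simps)

lemma oct_mult_one:
  fixes u :: "'a::field octonion"
  shows "1 * u = u" "u * 1 = u"
  by (cases u; auto simp: oct_defs mat2_simps)+

lemma oct_norm_mult:
  fixes u v :: "'a::field octonion"
  shows "oct_norm (u * v) = oct_norm u * oct_norm v"
  by (simp add: oct_defs mat2_simps) algebra

lemma oct_norm_scale:
  fixes u :: "'a::field octonion"
  shows "oct_norm (oct_scale c u) = c^2 * oct_norm u"
  by (simp add: oct_defs mat2_simps algebra_simps power2_eq_square)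

lemma oct_polar_bilinear:
  fixes u v w :: "'a::field octonion"
  shows "oct_polar (u + v) w = oct_polar u w + oct_polar v w"
    "oct_polar (oct_scale c u) w = c * oct_polar u w"
    "oct_polar u w = oct_polar w u"
  by (simp_all add: oct_polar_def oct_defs mat2_simps algebra_simps)

lemma oct_polar_nondegenerate:
  fixes u :: "'a::field octonion"
  assumes "\<And>v. oct_polar u v = 0"
  shows "u = 0"
proof -
  let ?M = "\<lambda>a b c d. vector [vector [a, b], vector [c, d]] :: 'a^2^2"
  show ?thesis
    using assms[of "Oct (?M 1 0 0 0) 0"] assms[of "Oct (?M 0 1 0 0) 0"]
      assms[of "Oct (?M 0 0 1 0) 0"] assms[of "Oct (?M 0 0 0 1) 0"]
      assms[of "Oct 0 (?M 1 0 0 0)"] assms[of "Oct 0 (?M 0 1 0 0)"]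
      assms[of "Oct 0 (?M 0 0 1 0)"] assms[of "Oct 0 (?M 0 0 0 1)"]
    by (cases u) (simp add: oct_polar_def oct_defs mat2_simps algebra_simps)
qed

lemma oct_split: "oct_p0 \<noteq> (0 :: 'a::field octonion)" "oct_norm oct_p0 = (0 :: 'a)"
  by (auto simp: oct_p0_def oct_defs mat2_simps)

lemma oct_w_square: "oct_w * oct_w = (1 :: 'a::field octonion)"
  by (auto simp: oct_w_def oct_defs mat2_simps)

lemma oct_conj_eq:
  fixes a x :: "'a::field^2^2"
  shows "oct_conj (Oct a x) = Oct (adjugate2 a) (- x)"
  by (auto simp: oct_conj_def oct_polar_def oct_defs mat2_simps algebra_simps)

lemma oct_dim: "oct.dim (UNIV :: 'a::field octonion set) = 8"
proof -
  let ?M = "\<lambda>a b c d. vector [vector [a, b], vector [c, d]] :: 'a^2^2"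
  define b where "b = (\<lambda>i::nat.
    if i < 4 then Oct (?M (of_bool (i=0)) (of_bool (i=1)) (of_bool (i=2)) (of_bool (i=3))) 0
    else Oct 0 (?M (of_bool (i=4)) (of_bool (i=5)) (of_bool (i=6)) (of_bool (i=7))))"
  let ?B = "b ` {..<8}"
  have inj: "inj_on b {..<8}"
    by (auto simp: b_def inj_on_def mat2_simps numeral_eq_Suc less_Suc_eq)
  have *: "(\<Sum>i<8. oct_scale (f i) (b i)) =
    Oct (?M (f 0) (f 1) (f 2) (f 3)) (?M (f 4) (f 5) (f 6) (f 7))" for f :: "nat \<Rightarrow> 'a"
    by (simp add: b_def numeral_eq_Suc lessThan_Suc oct_defs mat2_simps)
  have card: "card ?B = 8"
    using inj by (simp add: card_image)
  have indep: "oct.independent ?B"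
    unfolding oct.dependent_finite[OF finite_imageI[OF finite_lessThan]]
  proof (intro notI, elim exE conjE bexE)
    fix g v assume v: "v \<in> ?B" "g v \<noteq> 0" and "(\<Sum>v\<in>?B. oct_scale (g v) v) = 0"
    then have "(\<Sum>i<8. oct_scale (g (b i)) (b i)) = 0"
      by (simp add: sum.reindex[OF inj])
    then have "g (b i) = 0" if "i < 8" for i
      using that unfolding *
      by (auto simp: zero_octonion_def mat2_simps numeral_eq_Suc less_Suc_eq)
    with v show False by blast
  qed
  have "u \<in> oct.span ?B" for u
  proof -
    define f where "f = (\<lambda>i::nat. [oct_fst u $1$1, oct_fst u $1$2, oct_fst u $2$1, oct_fst u $2$2,
       oct_snd u $1$1, oct_snd u $1$2, oct_snd u $2$1, oct_snd u $2$2] ! i)"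
    have "u = (\<Sum>i<8. oct_scale (f i) (b i))"
      unfolding * by (cases u) (simp add: f_def mat2_simps)
    also have "\<dots> \<in> oct.span ?B"
      by (intro oct.span_sum oct.span_scale oct.span_base imageI) auto
    finally show ?thesis .
  qed
  then show ?thesis
    using oct.dim_unique[of ?B UNIV 8] indep card by auto
qed


section \<open>Subalgebras, morphisms and orbits\<close>

definition subalgebra :: "'a::field octonion set \<Rightarrow> bool" where
  "subalgebra A \<longleftrightarrow> oct.subspace A \<and> (\<forall>x\<in>A. \<forall>y\<in>A. x * y \<in> A)"

definition totally_singular :: "'a::field octonion set \<Rightarrow> bool" where
  "totally_singular A \<longleftrightarrow> oct_norm ` A = {0}"

definition ts_subalgebras :: "nat \<Rightarrow> 'a::field octonion set set" where
  "ts_subalgebras d = {A. subalgebra A \<and> totally_singular A \<and> oct.dim A = d}"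

text \<open>Isomorphisms of (not necessarily unital or associative) algebras with carriers \<open>A\<close>, \<open>B\<close> and
  scalar multiplications \<open>sA\<close>, \<open>sB\<close>.\<close>

definition algebra_iso ::
  "('f \<Rightarrow> 'b \<Rightarrow> 'b) \<Rightarrow> 'b::{plus,times} set \<Rightarrow>
   ('f \<Rightarrow> 'c \<Rightarrow> 'c) \<Rightarrow> 'c::{plus,times} set \<Rightarrow> ('b \<Rightarrow> 'c) \<Rightarrow> bool" where
  "algebra_iso sA A sB B f \<longleftrightarrow> bij_betw f A B \<and>
     (\<forall>x\<in>A. \<forall>y\<in>A. f (x + y) = f x + f y) \<and>
     (\<forall>c. \<forall>x\<in>A. f (sA c x) = sB c (f x)) \<and>
     (\<forall>x\<in>A. \<forall>y\<in>A. f (x * y) = f x * f y)"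

definition isomorphic_subalgebras ::
  "'a::field octonion set \<Rightarrow> 'a octonion set \<Rightarrow> bool" where
  "isomorphic_subalgebras A B \<longleftrightarrow> (\<exists>f. algebra_iso oct_scale A oct_scale B f)"

definition oct_Aut :: "('a::field octonion \<Rightarrow> 'a octonion) set" where
  "oct_Aut = {f. algebra_iso oct_scale UNIV oct_scale UNIV f}"

definition oct_anti_automorphism :: "('a::field octonion \<Rightarrow> 'a octonion) \<Rightarrow> bool" where
  "oct_anti_automorphism f \<longleftrightarrow> Vector_Spaces.linear oct_scale oct_scale f \<and> bij f \<and>
     (\<forall>x y. f (x * y) = f y * f x)"

definition oct_orbit :: "'a::field octonion set \<Rightarrow> 'a octonion set set" where
  "oct_orbit A = (\<lambda>f. f ` A) ` oct_Aut"

text \<open>The set of all orbits meeting \<open>S\<close>; for invariant \<open>S\<close>, the orbits into which \<open>S\<close> decomposes.\<close>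

definition oct_orbits :: "'a::field octonion set set \<Rightarrow> 'a octonion set set set" where
  "oct_orbits S = oct_orbit ` S"

definition has_left_identity :: "'a::field octonion set \<Rightarrow> bool" where
  "has_left_identity A \<longleftrightarrow> (\<exists>e\<in>A. \<forall>x\<in>A. e * x = x)"

definition has_right_identity :: "'a::field octonion set \<Rightarrow> bool" where
  "has_right_identity A \<longleftrightarrow> (\<exists>e\<in>A. \<forall>x\<in>A. x * e = x)"

definition trivial_mult :: "'a::field octonion set \<Rightarrow> bool" where
  "trivial_mult A \<longleftrightarrow> (\<forall>x\<in>A. \<forall>y\<in>A. x * y = 0)"

definition associative_on :: "'a::field octonion set \<Rightarrow> bool" where
  "associative_on A \<longleftrightarrow> (\<forall>x\<in>A. \<forall>y\<in>A. \<forall>z\<in>A. (x * y) * z = x * (y * z))"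

definition heisenberg_basis ::
  "'a::field octonion set \<Rightarrow> 'a octonion \<Rightarrow> 'a octonion \<Rightarrow> 'a octonion \<Rightarrow> bool" where
  "heisenberg_basis A x y n \<longleftrightarrow>
     distinct [x, y, n] \<and> oct.independent {x, y, n} \<and> oct.span {x, y, n} = A \<and>
     x * y = n \<and> y * x = - n \<and>
     x * x = 0 \<and> y * y = 0 \<and> n * n = 0 \<and> x * n = 0 \<and> n * x = 0 \<and> y * n = 0 \<and> n * y = 0"

definition heisenberg :: "'a::field octonion set \<Rightarrow> bool" where
  "heisenberg A \<longleftrightarrow> (\<exists>x y n. heisenberg_basis A x y n)"

definition left_mult_image :: "'a::field octonion \<Rightarrow> 'a octonion set" where
  "left_mult_image a = range (\<lambda>x. a * x)"

definition right_mult_image :: "'a::field octonion \<Rightarrow> 'a octonion set" where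
  "right_mult_image a = range (\<lambda>x. x * a)"

end

theory Submission
  imports Defs
begin

text \<open>
  A singular idempotent \<open>e\<close> splits the octonions into \<open>Fe + U + V + F(1 - e)\<close>, where \<open>eu = u\<close>, \<open>ue = 0\<close>
  on \<open>U\<close> and \<open>ev = 0\<close>, \<open>ve = v\<close> on \<open>V\<close>. A non-zero
  \<open>n \<in> U\<close> is completed by some \<open>m \<in> V\<close> to \<open>2 \<times> 2\<close> matrix units, and doubling with any \<open>w\<close> of norm
  \<open>-1\<close> orthogonal to them yields an automorphism. Hence the automorphism group is transitive
  on pairs \<open>(e, n)\<close>, on triples \<open>(e, n, y)\<close> with \<open>y \<in> V\<close> orthogonal to \<open>n\<close>, on nilpotent elements and
  on independent pairs with vanishing products.

  Let \<open>A\<close> be a totally singular subalgebra. If the trace vanishes on \<open>A\<close>, then \<open>A\<close> is anticommutative,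
  \<open>z(xy)\<close> is alternating and in fact \<open>0\<close>; so \<open>A\<close> annihilates \<open>n = xy\<close>, which gives the Heisenberg
  algebra unless all products are \<open>0\<close>. Otherwise \<open>A\<close> contains some \<open>e\<close> and
  \<open>A = Fe + (A \<inter> U) + (A \<inter> V)\<close> with \<open>A \<inter> U\<close> and \<open>A \<inter> V\<close> orthogonal. The product of two independent
  elements of \<open>U\<close> is a non-zero element of \<open>V\<close> orthogonal to both, and \<open>U\<close> is dual to \<open>V\<close>, so only six
  shapes remain.
\<close>

section \<open>Coordinates\<close>

text \<open>The field may have characteristic 2 and lack square roots, and this shapes the proof.
  Idempotents are handled through trace 1 and norm 0, alternative laws are kept beside their
  polarised forms, and a \<open>w\<close> of norm -1 arises by multiplying a non-singular vector of
  the complement by a quaternion of suitable norm, not by rescaling. On a totally singular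
  subalgebra the quadratic equation shrinks to xx = T(x)x. Hence a non-zero trace yields an
  idempotent, and trace zero can be recognised from the multiplication alone. The latter makes the
  normal forms distinguishable up to isomorphism and not merely up to automorphism, so isomorphic
  subalgebras share an orbit although no isomorphism is ever extended. Transitivity allows each
  structural argument to end in eight coordinates, where the polar form pairs 0 with 3, 1 with 2, 4
  with 7 and 5 with 6. For \<open>oct_p0\<close> the space U has the coordinates 1, 4, 6 and V has
  2, 5, 7.\<close>

definition oct8 :: "'a::field \<Rightarrow> 'a \<Rightarrow> 'a \<Rightarrow> 'a \<Rightarrow> 'a \<Rightarrow> 'a \<Rightarrow> 'a \<Rightarrow> 'a \<Rightarrow> 'a octonion" where
  "oct8 a b c d e f g h =
    Oct (vector [vector [a, b], vector [c, d]]) (vector [vector [e, f], vector [g, h]])"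

lemma oct8_cases [case_names oct8]:
  obtains a b c d e f g h where "u = oct8 a b c d e f g h"
proof (rule that)
  show "u = oct8 (oct_fst u $1$1) (oct_fst u $1$2) (oct_fst u $2$1) (oct_fst u $2$2)
     (oct_snd u $1$1) (oct_snd u $1$2) (oct_snd u $2$1) (oct_snd u $2$2)"
    by (cases u) (simp add: oct8_def mat2_simps)
qed

lemma oct8_eq_iff [simp]:
  "oct8 a b c d e f g h = oct8 a' b' c' d' e' f' g' h' \<longleftrightarrow>
    a = a' \<and> b = b' \<and> c = c' \<and> d = d' \<and> e = e' \<and> f = f' \<and> g = g' \<and> h = h'"
  by (auto simp: oct8_def mat2_simps)

lemma oct8_zero: "0 = oct8 0 0 0 0 0 0 0 0"
  and oct8_one: "1 = oct8 1 0 0 1 0 0 0 0"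
  and oct8_p0: "oct_p0 = oct8 1 0 0 0 0 0 0 0"
  and oct8_n0: "oct_n0 = oct8 0 1 0 0 0 0 0 0"
  and oct8_w: "oct_w = oct8 0 0 0 0 1 0 0 1"
  by (auto simp: oct8_def oct_defs oct_p0_def oct_n0_def oct_w_def mat2_simps)

lemma oct8_add: "oct8 a b c d e f g h + oct8 a' b' c' d' e' f' g' h' =
    oct8 (a + a') (b + b') (c + c') (d + d') (e + e') (f + f') (g + g') (h + h')"
  and oct8_diff: "oct8 a b c d e f g h - oct8 a' b' c' d' e' f' g' h' =
    oct8 (a - a') (b - b') (c - c') (d - d') (e - e') (f - f') (g - g') (h - h')"
  and oct8_uminus: "- oct8 a b c d e f g h = oct8 (-a) (-b) (-c) (-d) (-e) (-f) (-g) (-h)"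
  and oct8_scale: "oct_scale k (oct8 a b c d e f g h) =
    oct8 (k*a) (k*b) (k*c) (k*d) (k*e) (k*f) (k*g) (k*h)"
  by (auto simp: oct8_def oct_defs mat2_simps)

lemma oct8_mult: "oct8 a b c d e f g h * oct8 a' b' c' d' e' f' g' h' =
    oct8 (a*a' + b*c' + h'*e - f'*g) (a*b' + b*d' + h'*f - f'*h)
      (c*a' + d*c' - g'*e + e'*g) (c*b' + d*d' - g'*f + e'*h)
      (e'*a + f'*c + e*d' - f*c') (e'*b + f'*d - e*b' + f*a')
      (g'*a + h'*c + g*d' - h*c') (g'*b + h'*d - g*b' + h*a')"
  by (auto simp: oct8_def oct_defs mat2_simps)

lemma oct8_norm: "oct_norm (oct8 a b c d e f g h) = a*d - b*c - e*h + f*g"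
  by (simp add: oct8_def oct_defs mat2_simps)

lemma oct8_polar: "oct_polar (oct8 a b c d e f g h) (oct8 a' b' c' d' e' f' g' h') =
    a*d' + a'*d - b*c' - b'*c - e*h' - e'*h + f*g' + f'*g"
  by (simp add: oct_polar_def oct8_add oct8_norm algebra_simps)

lemma oct8_conj: "oct_conj (oct8 a b c d e f g h) = oct8 d (-b) (-c) a (-e) (-f) (-g) (-h)"
  by (simp add: oct_conj_def oct8_one oct8_polar oct8_scale oct8_diff)

lemmas oct8_simps = oct8_zero oct8_one oct8_p0 oct8_n0 oct8_w oct8_add oct8_diff oct8_uminus
  oct8_scale oct8_mult oct8_norm oct8_polar oct8_conj

section \<open>Standard units and the subspaces they span\<close>

definition oct_unit :: "nat \<Rightarrow> 'a::field octonion" where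
  "oct_unit i = oct8 (of_bool (i = 0)) (of_bool (i = 1)) (of_bool (i = 2)) (of_bool (i = 3))
    (of_bool (i = 4)) (of_bool (i = 5)) (of_bool (i = 6)) (of_bool (i = 7))"

lemma oct_sum_unit: "(\<Sum>i<8. oct_scale (f i) (oct_unit i)) =
    oct8 (f 0) (f 1) (f 2) (f 3) (f 4) (f 5) (f 6) (f (7::nat))"
  by (simp add: oct_unit_def numeral_eq_Suc lessThan_Suc oct8_simps)

definition coord_space :: "nat set \<Rightarrow> 'a::field octonion set" where
  "coord_space I = oct.span (oct_unit ` I)"

text \<open>For a literal index set the right-hand side simplifies to equations between coordinates,
  so closure, annihilators and inclusions of normal forms become computations.\<close>

lemma mem_coord_space:
  fixes a :: "'a::field"
  shows "oct8 a b c d e f g h \<in> coord_space I \<longleftrightarrow>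
    (0 \<notin> I \<longrightarrow> a = 0) \<and> (1 \<notin> I \<longrightarrow> b = 0) \<and> (2 \<notin> I \<longrightarrow> c = 0) \<and> (3 \<notin> I \<longrightarrow> d = 0) \<and>
    (4 \<notin> I \<longrightarrow> e = 0) \<and> (5 \<notin> I \<longrightarrow> f = 0) \<and> (6 \<notin> I \<longrightarrow> g = 0) \<and> (7 \<notin> I \<longrightarrow> h = 0)"
    (is "_ \<longleftrightarrow> ?R a b c d e f g h")
proof
  let ?S = "{u. \<exists>a b c d e f g h. u = oct8 a b c d e f g h \<and> ?R a b c d e f g h}"
  have *: "?R a b c d e f g h \<Longrightarrow> oct8 a b c d e f g h \<in> ?S" for a b c d e f g h
    by blast
  have "oct.subspace ?S"
  proof (rule oct.subspaceI)
    show "0 \<in> ?S" unfolding oct8_zero by (rule *) simp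
    fix u v assume "u \<in> ?S" "v \<in> ?S"
    then show "u + v \<in> ?S"
      by (elim CollectE exE conjE, simp only: oct8_add, intro * conjI impI) simp_all
  next
    fix k u assume "u \<in> ?S"
    then show "oct_scale k u \<in> ?S"
      by (elim CollectE exE conjE, simp only: oct8_scale, intro * conjI impI) simp_all
  qed
  moreover have "oct_unit ` I \<subseteq> ?S"
  proof
    fix v :: "'a octonion" assume "v \<in> oct_unit ` I"
    then obtain i where i: "i \<in> I" "v = oct_unit i"
      by blast
    show "v \<in> ?S"
      unfolding i(2) oct_unit_def using i(1) by (intro * conjI impI) (auto intro!: gr0I)
  qed
  ultimately have "coord_space I \<subseteq> ?S"
    unfolding coord_space_def by (rule oct.span_minimal[rotated])
  moreover assume "oct8 a b c d e f g h \<in> coord_space I"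
  ultimately have "oct8 a b c d e f g h \<in> ?S"
    by blast
  then show "?R a b c d e f g h"
    by (elim CollectE exE) simp
next
  assume R: "?R a b c d e f g h"
  define k where "k = (\<lambda>i::nat. [a, b, c, d, e, f, g, h] ! i)"
  have "oct8 a b c d e f g h = (\<Sum>i<8. oct_scale (k i) (oct_unit i))"
    by (simp add: oct_sum_unit k_def)
  also have "\<dots> \<in> coord_space I"
    unfolding coord_space_def
  proof (rule oct.span_sum)
    fix i :: nat assume "i \<in> {..<8}"
    then have "i = 0 \<or> i = 1 \<or> i = 2 \<or> i = 3 \<or> i = 4 \<or> i = 5 \<or> i = 6 \<or> i = 7"
      by auto
    then have "i \<notin> I \<longrightarrow> k i = 0"
      using R by (elim disjE) (simp_all add: k_def)
    then show "oct_scale (k i) (oct_unit i) \<in> oct.span (oct_unit ` I)"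
      by (auto intro: oct.span_scale oct.span_base oct.span_zero)
  qed
  finally show "oct8 a b c d e f g h \<in> coord_space I" .
qed

lemma inj_on_oct_unit: "inj_on oct_unit {..<8}"
  by (auto simp: oct_unit_def inj_on_def numeral_eq_Suc less_Suc_eq)

lemma independent_oct_unit: "oct.independent (oct_unit ` {..<8})"
  unfolding oct.dependent_finite[OF finite_imageI[OF finite_lessThan]]
proof (intro notI, elim exE conjE bexE)
  fix g v assume v: "v \<in> oct_unit ` {..<8}" "g v \<noteq> 0"
    and "(\<Sum>v\<in>oct_unit ` {..<8}. oct_scale (g v) v) = 0"
  then have "(\<Sum>i<8. oct_scale (g (oct_unit i)) (oct_unit i)) = 0"
    by (simp add: sum.reindex[OF inj_on_oct_unit])
  then have "g (oct_unit i) = 0" if "i < 8" for i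
    using that unfolding oct_sum_unit
    by (auto simp: oct8_zero numeral_eq_Suc less_Suc_eq)
  with v show False by blast
qed

text \<open>Makes every injective linear endomorphism surjective, which is how
  \<open>oct_AutI\<close> obtains bijectivity.\<close>

interpretation octf: finite_dimensional_vector_space oct_scale "oct_unit ` {..<8}"
proof
  have "u \<in> oct.span (oct_unit ` {..<8})" for u :: "'a octonion"
    by (cases u rule: oct8_cases) (simp add: mem_coord_space[unfolded coord_space_def])
  then show "oct.span (oct_unit ` {..<8}) = (UNIV :: 'a octonion set)"
    by auto
qed (simp_all add: independent_oct_unit)

lemma dim_coord_space:
  assumes "I \<subseteq> {..<8}"
  shows "oct.dim (coord_space I :: 'a::field octonion set) = card I"
proof -
  have "oct.independent (oct_unit ` I :: 'a octonion set)"
    using independent_oct_unit by (rule oct.independent_mono) (use assms in auto)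
  moreover have "card (oct_unit ` I :: 'a octonion set) = card I"
    by (intro card_image inj_on_subset[OF inj_on_oct_unit] assms)
  ultimately show ?thesis
    by (simp add: coord_space_def oct.dim_span oct.dim_eq_card_independent)
qed

lemma subspace_coord_space: "oct.subspace (coord_space I)"
  by (simp add: coord_space_def)


section \<open>Identities in the octonions\<close>

abbreviation oct_trace :: "'a::field octonion \<Rightarrow> 'a" where
  "oct_trace u \<equiv> oct_polar u 1"

lemma oct_mult_more:
  fixes u v w :: "'a::field octonion"
  shows "(u - v) * w = u * w - v * w" "u * (v - w) = u * v - u * w"
    "- u * v = - (u * v)" "u * - v = - (u * v)" "0 * u = 0" "u * 0 = 0"
  by (cases u rule: oct8_cases; cases v rule: oct8_cases; cases w rule: oct8_cases;
      simp add: oct8_simps algebra_simps)+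

lemmas oct_mult_simps = oct_mult_bilinear oct_mult_more oct_mult_one

lemma oct_polar_more:
  fixes u v w :: "'a::field octonion"
  shows "oct_polar u (v + w) = oct_polar u v + oct_polar u w"
    "oct_polar u (oct_scale c w) = c * oct_polar u w"
    "oct_polar (u - v) w = oct_polar u w - oct_polar v w"
    "oct_polar u (v - w) = oct_polar u v - oct_polar u w"
    "oct_polar (- u) w = - oct_polar u w"
    "oct_polar u (- w) = - oct_polar u w"
    "oct_polar 0 u = 0" "oct_polar u 0 = 0"
  by (cases u rule: oct8_cases; cases v rule: oct8_cases; cases w rule: oct8_cases;
      simp add: oct8_simps algebra_simps)+

lemmas oct_polar_simps = oct_polar_bilinear(1,2) oct_polar_more

text \<open>The Cayley-Hamilton equation for octonions. It ties trace and norm to the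
  multiplication, and for norm zero it makes xx a multiple of x.\<close>

lemma oct_square: "u * u = oct_scale (oct_trace u) u - oct_scale (oct_norm u) 1"
  by (cases u rule: oct8_cases) (simp add: oct8_simps algebra_simps)

lemma oct_left_alternative_lin:
  fixes u v w :: "'a::field octonion"
  shows "u * (v * w) + v * (u * w) = (u * v + v * u) * w"
  by (cases u rule: oct8_cases; cases v rule: oct8_cases; cases w rule: oct8_cases)
    (simp add: oct8_simps algebra_simps)

lemma oct_right_alternative_lin:
  fixes u v w :: "'a::field octonion"
  shows "(w * u) * v + (w * v) * u = w * (u * v + v * u)"
  by (cases u rule: oct8_cases; cases v rule: oct8_cases; cases w rule: oct8_cases)
    (simp add: oct8_simps algebra_simps)

text \<open>Putting equal arguments into the linearised laws gives only twice the first two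
  identities, which says nothing in characteristic 2.\<close>

lemma oct_alternative:
  fixes u v :: "'a::field octonion"
  shows "u * (u * v) = (u * u) * v" "(v * u) * u = v * (u * u)" "(u * v) * u = u * (v * u)"
  by (cases u rule: oct8_cases; cases v rule: oct8_cases; simp add: oct8_simps algebra_simps)+

text \<open>For singular \<open>u\<close> the last term vanishes, so \<open>u\<close> compresses the
  whole algebra to the line Fu. This produces idempotents from nilpotent elements and scalars from
  Peirce components.\<close>

lemma oct_sandwich:
  fixes u v :: "'a::field octonion"
  shows "(u * v) * u = oct_scale (oct_trace (u * v)) u - oct_scale (oct_norm u) (oct_conj v)"
  by (cases u rule: oct8_cases; cases v rule: oct8_cases; simp add: oct8_simps algebra_simps)

lemma oct_trace_mult_commute: "oct_trace (u * v) = oct_trace (v * u)"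
  by (cases u rule: oct8_cases; cases v rule: oct8_cases; simp add: oct8_simps algebra_simps)

text \<open>The trace form is associative although the product is not, so an idempotent can be moved
  across a product under the trace.\<close>

lemma oct_trace_mult_assoc: "oct_trace ((u * v) * w) = oct_trace (u * (v * w))"
  by (cases u rule: oct8_cases; cases v rule: oct8_cases; cases w rule: oct8_cases)
    (simp add: oct8_simps algebra_simps)

lemma oct_conj_mult: "oct_conj (u * v) = oct_conj v * oct_conj u"
  by (cases u rule: oct8_cases; cases v rule: oct8_cases; simp add: oct8_simps algebra_simps)

lemma oct_conj_conj [simp]: "oct_conj (oct_conj u) = u"
  by (cases u rule: oct8_cases) (simp add: oct8_simps)

lemma oct_norm_conj [simp]: "oct_norm (oct_conj u) = oct_norm u"
  by (cases u rule: oct8_cases) (simp add: oct8_simps algebra_simps)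

lemma oct_conj_linear:
  "oct_conj (u + v) = oct_conj u + oct_conj v" "oct_conj (oct_scale c u) = oct_scale c (oct_conj u)"
  by (cases u rule: oct8_cases; cases v rule: oct8_cases; simp add: oct8_simps algebra_simps)+

lemma oct_polar_eq_trace: "oct_polar u v = oct_trace (u * oct_conj v)"
  by (cases u rule: oct8_cases; cases v rule: oct8_cases; simp add: oct8_simps algebra_simps)

lemma oct_polar_mult_left: "oct_polar (u * v) w = oct_polar v (oct_conj u * w)"
  by (cases u rule: oct8_cases; cases v rule: oct8_cases; cases w rule: oct8_cases)
    (simp add: oct8_simps algebra_simps)

lemma oct_conj_scalar: "u * oct_conj v + v * oct_conj u = oct_scale (oct_polar u v) 1"
  by (cases u rule: oct8_cases; cases v rule: oct8_cases; simp add: oct8_simps algebra_simps)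

lemma oct_moufang_middle:
  fixes w :: "'a::field octonion"
  shows "(w * a) * (b * w) = (w * (a * b)) * w"
  by (cases w rule: oct8_cases; cases a rule: oct8_cases; cases b rule: oct8_cases)
    (simp add: oct8_simps algebra_simps)


section \<open>Automorphisms\<close>

lemma oct_conj_zero [simp]: "oct_conj 0 = 0"
  by (simp add: oct8_simps)

text \<open>By \<open>oct_conj_scalar\<close> the polar form is recovered from product and
  conjugation, so the kernel of \<open>f\<close> lies in the radical, which is zero. Finite
  dimension then gives surjectivity.\<close>

lemma oct_AutI:
  fixes f :: "'a::field octonion \<Rightarrow> 'a octonion"
  assumes add: "\<And>u v. f (u + v) = f u + f v"
    and scale: "\<And>c u. f (oct_scale c u) = oct_scale c (f u)"
    and mult: "\<And>u v. f (u * v) = f u * f v"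
    and one: "f 1 = 1"
    and conj: "\<And>u. f (oct_conj u) = oct_conj (f u)"
  shows "f \<in> oct_Aut"
proof -
  have lin: "Vector_Spaces.linear oct_scale oct_scale f"
    by unfold_locales (auto simp: add scale)
  then interpret f: Vector_Spaces.linear oct_scale oct_scale f .
  have "u = 0" if "f u = 0" for u
  proof (rule oct_polar_nondegenerate)
    fix v
    have "oct_scale (oct_polar u v) 1 = f (u * oct_conj v + v * oct_conj u)"
      by (simp add: oct_conj_scalar scale one)
    also have "\<dots> = 0"
      by (simp add: add mult conj that oct_mult_more oct_conj_zero)
    finally show "oct_polar u v = 0"
      by (simp add: oct8_simps)
  qed
  then have "inj f"
    by (simp add: f.inj_iff_eq_0)
  then have "bij f"
    using octf.linear_inj_imp_surj[OF lin] by (auto simp: bij_def)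
  then show ?thesis
    by (simp add: oct_Aut_def algebra_iso_def add scale mult)
qed

lemma oct_AutD:
  assumes "f \<in> oct_Aut"
  shows "bij f" "f (u + v) = f u + f v" "f (oct_scale c u) = oct_scale c (f u)"
    "f (u * v) = f u * f v"
  using assms by (auto simp: oct_Aut_def algebra_iso_def)

lemma oct_Aut_linear:
  assumes "f \<in> oct_Aut"
  shows "Vector_Spaces.linear oct_scale oct_scale f"
  by unfold_locales (auto simp: oct_AutD[OF assms])

lemma oct_Aut_one:
  assumes "f \<in> oct_Aut"
  shows "f 1 = 1"
proof -
  obtain u where "f u = 1"
    using oct_AutD(1)[OF assms] by (metis bij_pointE)
  then show ?thesis
    using oct_AutD(4)[OF assms, of u 1] by (simp add: oct_mult_one)
qed

lemma oct_Aut_zero: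
  assumes "f \<in> oct_Aut"
  shows "f 0 = 0"
  using oct_AutD(2)[OF assms, of 0 0] by simp

lemma oct_Aut_id: "id \<in> oct_Aut"
  by (simp add: oct_Aut_def algebra_iso_def)

lemma oct_Aut_comp:
  assumes "f \<in> oct_Aut" "g \<in> oct_Aut"
  shows "f \<circ> g \<in> oct_Aut"
  using assms by (auto simp: oct_Aut_def algebra_iso_def intro: bij_comp)

lemma oct_Aut_inv:
  assumes "f \<in> oct_Aut"
  shows "inv f \<in> oct_Aut"
proof -
  have b: "bij f" using assms by (rule oct_AutD)
  have f: "f (inv f u) = u" for u
    by (simp add: b bij_is_surj surj_f_inv_f)
  have "inv f u = v \<longleftrightarrow> u = f v" for u v
    using b by (metis bij_inv_eq_iff)
  then show ?thesis
    using b by (simp add: oct_Aut_def algebra_iso_def bij_imp_bij_inv oct_AutD[OF assms] f)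
qed

text \<open>A non-scalar \<open>u\<close> is independent of 1, so it satisfies at most one equation
  of this shape. Hence automorphisms must preserve trace and norm.\<close>

lemma oct_quadratic_unique:
  assumes "u * u = oct_scale t u - oct_scale k 1" "u \<notin> range (\<lambda>c. oct_scale c 1)"
  shows "t = oct_trace u" "k = oct_norm u"
proof -
  have eq: "oct_scale (t - oct_trace u) u = oct_scale (k - oct_norm u) 1"
    using assms(1) unfolding oct_square by (simp add: oct.scale_left_diff_distrib algebra_simps)
  show t: "t = oct_trace u"
  proof (rule ccontr)
    assume "t \<noteq> oct_trace u"
    then have "u = oct_scale (inverse (t - oct_trace u)) (oct_scale (t - oct_trace u) u)"
      by simp
    then have "u = oct_scale (inverse (t - oct_trace u) * (k - oct_norm u)) 1"
      unfolding eq by simp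
    with assms(2) show False by blast
  qed
  show "k = oct_norm u"
    using eq t by (simp add: oct8_simps)
qed

lemma oct_Aut_trace_norm:
  assumes "f \<in> oct_Aut"
  shows oct_Aut_trace: "oct_trace (f u) = oct_trace u"
    and oct_Aut_norm: "oct_norm (f u) = oct_norm u"
proof -
  interpret f: Vector_Spaces.linear oct_scale oct_scale f
    by (rule oct_Aut_linear[OF assms])
  note D = oct_AutD[OF assms] oct_Aut_one[OF assms]
  have "oct_trace (f u) = oct_trace u \<and> oct_norm (f u) = oct_norm u"
  proof (cases "u \<in> range (\<lambda>c. oct_scale c 1)")
    \<comment> \<open>A scalar satisfies many quadratic equations, but it is fixed by
      \<open>f\<close> outright.\<close>
    case True
    then show ?thesis by (auto simp: D)
  next
    case False
    have "f u \<notin> range (\<lambda>c. oct_scale c 1)"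
    proof
      assume "f u \<in> range (\<lambda>c. oct_scale c 1)"
      then obtain c where "f u = f (oct_scale c 1)"
        by (auto simp: D)
      then have "u = oct_scale c 1"
        using D(1) by (meson bij_is_inj injD)
      with False show False by blast
    qed
    moreover have "f u * f u = oct_scale (oct_trace u) (f u) - oct_scale (oct_norm u) 1"
      by (simp add: oct_square[of u] f.diff D flip: D(4))
    ultimately show ?thesis
      using oct_quadratic_unique by metis
  qed
  then show "oct_trace (f u) = oct_trace u" "oct_norm (f u) = oct_norm u"
    by auto
qed

lemma oct_Aut_conj:
  assumes "f \<in> oct_Aut"
  shows "f (oct_conj u) = oct_conj (f u)"
proof -
  interpret f: Vector_Spaces.linear oct_scale oct_scale f
    by (rule oct_Aut_linear[OF assms])
  show ?thesis
    by (simp add: oct_conj_def f.diff oct_AutD(3)[OF assms] oct_Aut_one[OF assms]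
        oct_Aut_trace[OF assms])
qed

subsection \<open>Extending matrix units and an orthogonal element to an automorphism\<close>

lemma oct_polar_commute: "oct_polar u v = oct_polar v u"
  by (rule oct_polar_bilinear)

lemma oct_conj_traceless:
  assumes "oct_trace u = 0"
  shows "oct_conj u = - u"
  using assms by (simp add: oct_conj_def)

lemma oct_orthogonal_commute:
  assumes "oct_trace w = 0" "oct_polar a w = 0"
  shows "a * w = w * oct_conj a"
  using oct_conj_scalar[of a w] assms
  by (simp add: oct_conj_traceless oct_mult_simps)

text \<open>The lemmas \<open>oct_double_mult1-3\<close> give the products in the doubling formula for \<open>(a + xw)(b + yw)\<close>, with
  \<open>w\<close> orthogonal to the subalgebra generated by the other factors.\<close>

lemma oct_double_mult1:
  assumes "oct_trace w = 0" "oct_polar a w = 0" "oct_polar y w = 0" "oct_polar (y * a) w = 0"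
  shows "a * (y * w) = (y * a) * w"
proof -
  have "a * w = w * oct_conj a"
    by (rule oct_orthogonal_commute) fact+
  then have "a * w + w * a = oct_scale (oct_trace a) w"
    by (simp add: oct_conj_def oct_mult_simps)
  \<comment> \<open>Multiplying by \<open>oct_conj y\<close> on the right, polarised left
    alternativity moves the new factor inside.\<close>
  then have "a * (w * oct_conj y) + w * (a * oct_conj y) = oct_scale (oct_trace a) (w * oct_conj y)"
    by (simp add: oct_left_alternative_lin oct_mult_simps)
  then have "a * (w * oct_conj y) = w * (oct_conj a * oct_conj y)"
    by (simp add: oct_conj_def[of a] oct_mult_simps algebra_simps)
  also have "\<dots> = (y * a) * w"
    using oct_orthogonal_commute[OF assms(1,4)] by (simp add: oct_conj_mult)
  finally show ?thesis
    using oct_orthogonal_commute[OF assms(1,3)] by simp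
qed

lemma oct_double_conj:
  assumes "oct_trace w = 0" "oct_polar x w = 0"
  shows "oct_conj (x * w) = - (x * w)"
  using oct_orthogonal_commute[OF assms] assms(1)
  by (simp add: oct_conj_mult oct_conj_traceless oct_mult_simps)

lemma oct_polar_conj: "oct_polar (oct_conj u) v = oct_polar u (oct_conj v)"
  by (cases u rule: oct8_cases; cases v rule: oct8_cases; simp add: oct8_simps algebra_simps)

lemma oct_double_mult2:
  assumes "oct_trace w = 0" "oct_polar x w = 0" "oct_polar b w = 0"
    "oct_polar (x * oct_conj b) w = 0"
  shows "(x * w) * b = (x * oct_conj b) * w"
proof -
  have "oct_polar (oct_conj b) w = 0"
    using assms by (simp add: oct_polar_conj oct_conj_traceless oct_polar_more)
  then have "oct_conj b * (x * w) = (x * oct_conj b) * w"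
    by (intro oct_double_mult1 assms)
  \<comment> \<open>Conjugation reverses the factors and negates both elements of the form
    (quaternion)w, so the signs cancel.\<close>
  then have "oct_conj (oct_conj b * (x * w)) = oct_conj ((x * oct_conj b) * w)"
    by simp
  then show ?thesis
    using assms by (simp add: oct_conj_mult[of "oct_conj b"] oct_double_conj oct_mult_more)
qed

lemma oct_double_mult3:
  assumes "oct_trace w = 0" "oct_norm w = -1" "oct_polar x w = 0" "oct_polar y w = 0"
    "oct_polar (oct_conj x * y) w = 0"
  shows "(x * w) * (y * w) = oct_conj y * x"
proof -
  \<comment> \<open>Rewriting \<open>x * w\<close> as \<open>w * oct_conj x\<close> gives the shape
    of the middle Moufang identity.\<close>
  have "(x * w) * (y * w) = (w * (oct_conj x * y)) * w"
    by (simp add: oct_orthogonal_commute[OF assms(1,3)] oct_moufang_middle)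
  also have "w * (oct_conj x * y) = (oct_conj y * x) * w"
  proof -
    have "oct_polar (oct_conj y * x) w = oct_polar (oct_conj x * y) (oct_conj w)"
      by (simp add: oct_conj_mult flip: oct_polar_conj)
    then show ?thesis
      using oct_orthogonal_commute[of w "oct_conj y * x"] assms
      by (simp add: oct_conj_mult oct_polar_more oct_conj_traceless)
  qed
  \<comment> \<open>Trace 0 and norm -1 give \<open>w * w = 1\<close>.\<close>
  also have "\<dots> * w = oct_conj y * x"
    using oct_square[of w] assms by (simp add: oct_alternative oct_mult_simps)
  finally show ?thesis .
qed

lemma oct_trace_one: "oct_trace (1 :: 'a::field octonion) = 2"
  by (simp add: oct8_simps)

text \<open>The doubling formula over the copy of the matrix algebra spanned by \<open>e\<close>,
  \<open>n\<close>, \<open>m\<close>, \<open>1 - e\<close>, with \<open>w\<close> in the role of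
  \<open>oct_w\<close>. Matching products and conjugation suffices, because \<open>oct_AutI\<close>
  supplies bijectivity.\<close>

lemma oct_Aut_from_matrix_units:
  fixes e n m w :: "'a::field octonion"
  assumes mult: "e * e = e" "e * n = n" "n * e = 0" "e * m = 0" "m * e = m"
      "n * n = 0" "m * m = 0" "n * m = e" "m * n = 1 - e"
    and trace: "oct_trace e = 1" "oct_trace n = 0" "oct_trace m = 0"
    and orth: "oct_trace w = 0" "oct_polar e w = 0" "oct_polar n w = 0" "oct_polar m w = 0"
    and norm: "oct_norm w = -1"
  shows "\<exists>f\<in>oct_Aut. \<forall>a b c d a' b' c' d'. f (oct8 a b c d a' b' c' d') =
    (oct_scale a e + oct_scale b n + oct_scale c m + oct_scale d (1 - e)) +
    (oct_scale a' e + oct_scale b' n + oct_scale c' m + oct_scale d' (1 - e)) * w"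
proof -
  define g where "g A = oct_scale (A$1$1) e + oct_scale (A$1$2) n + oct_scale (A$2$1) m
     + oct_scale (A$2$2) (1 - e)" for A :: "'a^2^2"
  have g_add: "g (A + B) = g A + g B" for A B
    by (simp add: g_def oct.scale_left_distrib)
  have g_scale: "g (\<chi> i j. c * A $ i $ j) = oct_scale c (g A)" for c A
    by (simp add: g_def oct.scale_right_distrib)
  have g_mult: "g (A ** B) = g A * g B" for A B
    by (simp add: g_def matrix_matrix_mult_def sum_2 oct_mult_simps mult
        oct.scale_left_distrib oct.scale_right_distrib oct.scale_right_diff_distrib algebra_simps)
  have g_one: "g (mat 1) = 1"
    by (simp add: g_def mat_def)
  have g_conj: "g (adjugate2 A) = oct_conj (g A)" for A
    by (simp add: g_def adjugate2_def oct_conj_def oct_polar_simps trace oct_trace_one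
        oct.scale_left_distrib oct.scale_right_diff_distrib algebra_simps)
  have one_w: "oct_polar 1 w = 0"
    using orth by (simp add: oct_polar_commute)
  have g_orth: "oct_polar (g A) w = 0" for A
    by (simp add: g_def oct_polar_simps orth one_w)
  define f where "f u = g (oct_fst u) + g (oct_snd u) * w" for u
  have "f \<in> oct_Aut"
  proof (rule oct_AutI)
    show "f (u + v) = f u + f v" for u v
      by (simp add: f_def plus_octonion_def[of u v] g_add oct_mult_simps algebra_simps)
    show "f (oct_scale c u) = oct_scale c (f u)" for c u
      by (simp add: f_def oct_scale_def[of c u] g_scale oct_mult_simps oct.scale_right_distrib)
    show "f 1 = 1"
      using g_add[of 0 0] by (simp add: f_def one_octonion_def g_one oct_mult_more)
    have w1: "g A * (g B * w) = g (B ** A) * w" for A B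
      unfolding g_mult by (rule oct_double_mult1) (use g_orth[of "B ** A"] in \<open>simp_all add: orth g_orth g_mult\<close>)
    have w2: "(g A * w) * g B = g (A ** adjugate2 B) * w" for A B
      unfolding g_mult g_conj by (rule oct_double_mult2)
        (use g_orth[of "A ** adjugate2 B"] in \<open>simp_all add: orth g_orth g_mult g_conj\<close>)
    have w3: "(g A * w) * (g B * w) = g (adjugate2 B ** A)" for A B
      unfolding g_mult g_conj by (rule oct_double_mult3)
        (use g_orth[of "adjugate2 A ** B"] in \<open>simp_all add: orth norm g_orth g_mult g_conj\<close>)
    show "f (u * v) = f u * f v" for u v
      by (simp add: f_def times_octonion_def[of u v] oct_mult_bilinear(1,2) w1 w2 w3 g_add g_mult algebra_simps)
    show "f (oct_conj u) = oct_conj (f u)" for u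
    proof (cases u)
      case (Oct A B)
      have "g (- B) = - g B"
        using g_add[of "- B" B] g_add[of 0 0] by (simp add: eq_neg_iff_add_eq_0)
      with Oct show ?thesis
        by (simp add: f_def oct_conj_eq g_conj oct_conj_linear oct_double_conj orth g_orth oct_mult_more)
    qed
  qed
  then show ?thesis
    by (intro bexI[of _ f]) (auto simp: f_def g_def oct8_def)
qed


section \<open>Peirce spaces and transitivity of the automorphism group\<close>

text \<open>Trace 1 and norm 0 force \<open>e * e = e\<close> by the quadratic equation and exclude
  0 and 1. Any singular element of non-zero trace becomes such an element after rescaling.\<close>

definition singular_idempotent :: "'a::field octonion \<Rightarrow> bool" where
  "singular_idempotent e \<longleftrightarrow> oct_trace e = 1 \<and> oct_norm e = 0"

definition peirce10 :: "'a::field octonion \<Rightarrow> 'a octonion set" where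
  "peirce10 e = {x. e * x = x \<and> x * e = 0}"

definition peirce01 :: "'a::field octonion \<Rightarrow> 'a octonion set" where
  "peirce01 e = {x. e * x = 0 \<and> x * e = x}"

lemma peirce10D: "x \<in> peirce10 e \<Longrightarrow> e * x = x" "x \<in> peirce10 e \<Longrightarrow> x * e = 0"
  and peirce01D: "y \<in> peirce01 e \<Longrightarrow> e * y = 0" "y \<in> peirce01 e \<Longrightarrow> y * e = y"
  by (auto simp: peirce10_def peirce01_def)

lemma singular_idempotent_mult:
  assumes "singular_idempotent e"
  shows "e * e = e" "e * (e * x) = e * x" "(x * e) * e = x * e"
  using oct_square[of e] assms by (simp_all add: singular_idempotent_def oct_alternative)

lemma oct_polar_self: "oct_polar u u = 2 * oct_norm u"
  by (cases u rule: oct8_cases) (simp add: oct8_simps algebra_simps)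

lemma oct_polar_traceless:
  assumes "oct_trace v = 0"
  shows "oct_polar u v = - oct_trace (u * v)"
  using assms by (simp add: oct_polar_eq_trace[of u v] oct_conj_traceless oct_mult_more oct_polar_more)

lemma oct_norm_add: "oct_norm (u + v) = oct_norm u + oct_norm v + oct_polar u v"
  by (simp add: oct_polar_def)

lemma oct_norm_uminus [simp]: "oct_norm (- u) = oct_norm u"
  by (cases u rule: oct8_cases) (simp add: oct8_simps)

text \<open>The products with \<open>e\<close> on the two sides have the same trace, but one of them
  is the element itself and the other is zero.\<close>

lemma peirce_traceless:
  "x \<in> peirce10 e \<Longrightarrow> oct_trace x = 0" "y \<in> peirce01 e \<Longrightarrow> oct_trace y = 0"
  using oct_trace_mult_commute[of e x] oct_trace_mult_commute[of e y]
  by (auto simp: peirce10_def peirce01_def oct_polar_more)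

lemma peirce_singular:
  assumes "oct_norm e = 0"
  shows "x \<in> peirce10 e \<Longrightarrow> oct_norm x = 0" "y \<in> peirce01 e \<Longrightarrow> oct_norm y = 0"
  using assms oct_norm_mult[of e x] oct_norm_mult[of y e]
  by (auto simp: peirce10_def peirce01_def)

text \<open>Moving \<open>e\<close> across the product under the trace turns T(xx') into T((xe)x') =
  0. So U is isotropic, and likewise V.\<close>

lemma peirce10_polar:
  assumes "x \<in> peirce10 e" "x' \<in> peirce10 e"
  shows "oct_polar x x' = 0"
  using assms oct_trace_mult_assoc[of x e x'] peirce_traceless(1)[OF assms(2)]
  by (simp add: oct_polar_traceless peirce10D oct_mult_more oct_polar_more)

lemma peirce01_polar:
  assumes "x \<in> peirce01 e" "x' \<in> peirce01 e"
  shows "oct_polar x x' = 0"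
  using assms oct_trace_mult_assoc[of x e x'] peirce_traceless(2)[OF assms(2)]
  by (simp add: oct_polar_traceless peirce01D oct_mult_more oct_polar_more)

lemma peirce_polar_idempotent:
  "x \<in> peirce10 e \<Longrightarrow> oct_polar e x = 0" "y \<in> peirce01 e \<Longrightarrow> oct_polar e y = 0"
  using peirce_traceless[of _ e]
  by (simp_all add: oct_polar_traceless peirce10D peirce01D oct_polar_more)

lemma ex_trace_mult_one:
  fixes x :: "'a::field octonion"
  assumes "x \<noteq> 0"
  obtains c where "oct_trace (x * c) = 1"
proof -
  obtain d where d: "oct_polar x d \<noteq> 0"
    using assms oct_polar_nondegenerate by blast
  have "oct_trace (x * oct_scale (inverse (oct_polar x d)) (oct_conj d)) = 1"
    using d by (simp add: oct_mult_bilinear oct_polar_bilinear(2) flip: oct_polar_eq_trace)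
  then show thesis by (rule that)
qed

text \<open>The element \<open>m\<close> is the V-part of some \<open>c\<close> with T(nc) = 1.
  Since nm is fixed by \<open>e\<close> on both sides, \<open>oct_sandwich\<close> makes it T(nm)e =
  e. Then mn = 1 - e, because traceless \<open>n\<close> and \<open>m\<close> with polar value -1
  satisfy nm + mn = 1.\<close>

lemma peirce10_matrix_units:
  fixes e n :: "'a::field octonion"
  assumes e: "singular_idempotent e" and n: "n \<in> peirce10 e" "n \<noteq> 0"
  obtains m where "m \<in> peirce01 e" "n * m = e" "m * n = 1 - e"
proof -
  note ee = singular_idempotent_mult[OF e]
  obtain c where c: "oct_trace (n * c) = 1"
    using ex_trace_mult_one[OF n(2)] .
  define m where "m = c * e - e * (c * e)"
  have m: "m \<in> peirce01 e"
    by (simp add: peirce01_def m_def oct_mult_more ee flip: oct_alternative(3))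
  have "oct_trace (n * (c * e)) = oct_trace (e * (n * c))"
    unfolding oct_trace_mult_assoc[symmetric] by (subst oct_trace_mult_commute) (simp add: oct_trace_mult_assoc)
  also have "\<dots> = 1"
    by (simp add: c peirce10D[OF n(1)] flip: oct_trace_mult_assoc)
  finally have t: "oct_trace (n * m) = 1"
    using oct_trace_mult_assoc[of n e "c * e"]
    by (simp add: m_def oct_mult_more oct_polar_more peirce10D[OF n(1)])
  have "e * (n * m) = n * m"
    using oct_left_alternative_lin[of e n m] peirce10D[OF n(1)] peirce01D[OF m]
    by (simp add: oct_mult_more)
  moreover have "(n * m) * e = n * m"
    using oct_right_alternative_lin[of n m e] peirce10D[OF n(1)] peirce01D[OF m]
    by (simp add: oct_mult_more)
  ultimately have nm: "n * m = e"
    using oct_sandwich[of e "n * m"] e t by (simp add: singular_idempotent_def)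
  have "oct_polar n m = - 1"
    using oct_polar_traceless[of m n] peirce_traceless(2)[OF m] t by simp
  then have "m * n = 1 - e"
    using oct_conj_scalar[of n m] nm peirce_traceless(1)[OF n(1)] peirce_traceless(2)[OF m]
    by (simp add: oct_conj_traceless oct_mult_more eq_diff_eq algebra_simps minus_equation_iff)
  with m nm show thesis by (rule that)
qed

lemma oct_dim_contradiction:
  assumes "finite W" "card W < 8" "\<And>u :: 'a::field octonion. u \<in> oct.span W"
  shows False
  using oct.dim_le_card[of UNIV W] assms oct_dim[where 'a = 'a] by auto

text \<open>If U were zero, then eO = Fe. The adjoint of left multiplication by \<open>e\<close> is
  left multiplication by \<open>1 - e\<close>, so (1 - e)O would be a line as well, and O = eO + (1
  - e)O would have dimension 2.\<close>

lemma ex_peirce10: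
  fixes e :: "'a::field octonion"
  assumes e: "singular_idempotent e"
  obtains n where "n \<in> peirce10 e" "n \<noteq> 0"
proof -
  note ee = singular_idempotent_mult[OF e]
  have e1: "oct_conj e = 1 - e"
    using e by (simp add: oct_conj_def singular_idempotent_def)
  have "\<exists>n\<in>peirce10 e. n \<noteq> 0"
  proof (rule ccontr)
    assume *: "\<not> (\<exists>n\<in>peirce10 e. n \<noteq> 0)"
    have ec: "e * c = oct_scale (oct_trace (e * c)) e" for c
    proof -
      have "e * c - (e * c) * e \<in> peirce10 e"
        by (simp add: peirce10_def oct_mult_more ee)
          (simp add: oct_alternative(3)[of e c] ee)
      with * have "e * c = (e * c) * e"
        by auto
      then show ?thesis
        using oct_sandwich[of e c] e by (simp add: singular_idempotent_def)
    qed
    have "d \<in> oct.span {e, 1}" for d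
    proof -
      have "oct_conj e * d - oct_scale (oct_polar d e) (oct_conj e) = 0"
      proof (rule oct_polar_nondegenerate)
        fix c
        have "oct_polar (oct_conj e) c = oct_trace (e * c)"
          by (simp add: oct_polar_commute[of "oct_conj e"] oct_polar_eq_trace[of c "oct_conj e"]
              oct_trace_mult_commute[of c])
        moreover have "oct_polar (oct_conj e * d) c = oct_trace (e * c) * oct_polar d e"
          unfolding oct_polar_mult_left[of "oct_conj e" d c] oct_conj_conj
          by (subst ec) (simp add: oct_polar_more)
        ultimately show "oct_polar (oct_conj e * d - oct_scale (oct_polar d e) (oct_conj e)) c = 0"
          by (simp add: oct_polar_simps)
      qed
      then have "d - e * d = oct_scale (oct_polar d e) (1 - e)"
        by (simp add: e1 oct_mult_simps)
      then have "d = oct_scale (oct_trace (e * d)) e + oct_scale (oct_polar d e) (1 - e)"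
        by (simp add: ec[symmetric] algebra_simps)
      then show ?thesis
        by (metis insertI1 insert_commute oct.span_add oct.span_base oct.span_diff oct.span_scale)
    qed
    then show False
      by (rule oct_dim_contradiction[rotated 2]) (auto simp: card_insert_if)
  qed
  then show thesis using that by blast
qed

section \<open>Matrix units and the complement of their quaternion subalgebra\<close>

locale matrix_units =
  fixes e n m :: "'a::field octonion"
  assumes e: "singular_idempotent e" and n: "n \<in> peirce10 e" and m: "m \<in> peirce01 e"
    and nm: "n * m = e" and mn: "m * n = 1 - e"
begin

lemma traces: "oct_trace e = 1" "oct_trace n = 0" "oct_trace m = 0"
  using e peirce_traceless n m by (auto simp: singular_idempotent_def)

lemma norms: "oct_norm e = 0" "oct_norm n = 0" "oct_norm m = 0"
  using e peirce_singular n m by (auto simp: singular_idempotent_def)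

lemma polars: "oct_polar e n = 0" "oct_polar e m = 0" "oct_polar n m = - 1"
    "oct_polar n e = 0" "oct_polar m e = 0" "oct_polar m n = - 1"
    "oct_polar 1 e = 1" "oct_polar 1 n = 0" "oct_polar 1 m = 0"
    "oct_polar e e = 0" "oct_polar n n = 0" "oct_polar m m = 0"
  using peirce_polar_idempotent n m traces oct_polar_traceless[of m n]
  by (auto simp: nm oct_polar_commute[of n e] oct_polar_commute[of m e] oct_polar_commute[of m n]
      oct_polar_commute[of 1 e] oct_polar_commute[of 1 n] oct_polar_commute[of 1 m]
      oct_polar_self norms)

lemma products: "e * e = e" "e * n = n" "n * e = 0" "e * m = 0" "m * e = m"
      "n * n = 0" "m * m = 0" "n * m = e" "m * n = 1 - e"
  using singular_idempotent_mult(1)[OF e] peirce10D[OF n] peirce01D[OF m] nm mn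
    oct_square[of n] oct_square[of m]
  by (auto simp: traces norms)

lemmas automorphism = oct_Aut_from_matrix_units[OF products traces]

text \<open>If the norm vanished on the complement of the quaternion subalgebra, polarisation would
  put the complement into the radical, leaving dimension at most 4. Norm -1 is reached without
  square roots: e - k(1 - e) has norm -k, because \<open>e\<close> and \<open>1 - e\<close> form a
  hyperbolic pair.\<close>

lemma ex_orthogonal:
  obtains w where "oct_trace w = 0" "oct_polar e w = 0" "oct_polar n w = 0" "oct_polar m w = 0"
    "oct_norm w = -1"
proof -
  \<comment> \<open>orthogonal projection onto the complement of the quaternion subalgebra\<close>
  define p where "p x = x - oct_scale (oct_polar x (1 - e)) e - oct_scale (oct_polar x e) (1 - e)
    + oct_scale (oct_polar x m) n + oct_scale (oct_polar x n) m" for x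
  have p_add: "p (x + y) = p x + p y" for x y
    by (simp add: p_def oct_polar_simps oct.scale_left_distrib algebra_simps)
  have orth: "oct_polar (p x) 1 = 0" "oct_polar (p x) e = 0" "oct_polar (p x) n = 0"
    "oct_polar (p x) m = 0" for x
    by (simp_all add: p_def oct_polar_simps polars traces oct_trace_one algebra_simps)
  have "\<exists>x. oct_norm (p x) \<noteq> 0"
  proof (rule ccontr)
    assume *: "\<not> (\<exists>x. oct_norm (p x) \<noteq> 0)"
    have "x \<in> oct.span {e, n, m, 1}" for x
    proof -
      have "p x = 0"
      proof (rule oct_polar_nondegenerate)
        fix y
        have "oct_polar (p x) (p y) = 0"
          using * by (simp add: oct_polar_def flip: p_add)
        then show "oct_polar (p x) y = 0"
          by (simp add: p_def[of y] oct_polar_simps orth)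
      qed
      then have "x = oct_scale (oct_polar x (1 - e)) e + oct_scale (oct_polar x e) (1 - e)
          - oct_scale (oct_polar x m) n - oct_scale (oct_polar x n) m"
        by (simp add: p_def algebra_simps)
      also have "\<dots> \<in> oct.span {e, n, m, 1}"
        by (intro oct.span_add oct.span_diff oct.span_scale) (auto intro: oct.span_base)
      finally show ?thesis .
    qed
    then show False
      by (rule oct_dim_contradiction[rotated 2]) (auto simp: card_insert_if)
  qed
  then obtain x where x: "oct_norm (p x) \<noteq> 0" by blast
  \<comment> \<open>left multiplication by \<open>a\<close> preserves that complement and rescales the norm to \<open>-1\<close>\<close>
  define k where "k = inverse (oct_norm (p x))"
  define a where "a = e - oct_scale k (1 - e)"
  have conj_e: "oct_conj e = 1 - e"
    by (simp add: oct_conj_def traces)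
  have conj_a: "oct_conj a = 1 - e - oct_scale k e"
    by (simp add: a_def oct_conj_def oct_polar_simps traces oct_trace_one
        oct.scale_left_diff_distrib oct.scale_right_diff_distrib algebra_simps)
  \<comment> \<open>The adjoint of left multiplication by \<open>a\<close> is left multiplication by
    \<open>oct_conj a\<close>, which keeps \<open>e\<close>, \<open>n\<close>, \<open>m\<close> and
    1 inside the quaternion subalgebra.\<close>
  have orth': "oct_polar (a * p x) h = oct_polar (p x) (h - e * h - oct_scale k (e * h))" for h
    by (simp add: oct_polar_mult_left conj_a oct_mult_simps)
  have "oct_norm (1 - e) = 0"
    using norms(1) oct_norm_conj[of e] by (simp add: conj_e)
  then have "oct_norm a = - k"
    using oct_norm_add[of e "oct_scale (- k) (1 - e)"]
    by (simp add: a_def norms oct_norm_scale oct_polar_simps traces polars)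
  then have "oct_norm (a * p x) = - 1"
    using x by (simp add: oct_norm_mult k_def)
  moreover have "oct_polar (a * p x) 1 = 0" "oct_polar e (a * p x) = 0" "oct_polar n (a * p x) = 0"
    "oct_polar m (a * p x) = 0"
    by (simp_all add: oct_polar_commute[of _ "a * p x"] orth' oct_mult_simps products oct_polar_simps orth)
  ultimately show thesis
    using that by blast
qed

end

section \<open>Transitivity on idempotents, nilpotent elements and null pairs\<close>

lemma oct_Aut_transitive_peirce10:
  assumes "singular_idempotent e" "n \<in> peirce10 e" "n \<noteq> 0"
  shows "\<exists>f\<in>oct_Aut. f oct_p0 = e \<and> f oct_n0 = n"
proof -
  obtain m where m: "m \<in> peirce01 e" "n * m = e" "m * n = 1 - e"
    using peirce10_matrix_units[OF assms] .
  interpret matrix_units e n m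
    by unfold_locales (fact assms m)+
  obtain w where "oct_trace w = 0" "oct_polar e w = 0" "oct_polar n w = 0" "oct_polar m w = 0"
    "oct_norm w = -1"
    using ex_orthogonal .
  from automorphism[OF this] show ?thesis
    by (auto simp: oct8_p0 oct8_n0 oct_mult_more elim!: bexI[rotated])
qed

text \<open>The lower right matrix unit times \<open>oct_w\<close>. It lies in V for
  \<open>oct_p0\<close>, is orthogonal to \<open>oct_n0\<close> and has zero products with
  it.\<close>

abbreviation oct_v0 :: "'a::field octonion" where
  "oct_v0 \<equiv> oct8 0 0 0 0 0 0 0 1"

text \<open>The doubling element is \<open>z' + y\<close> with \<open>z'\<close> in U, so that
  multiplication by \<open>1 - e\<close> leaves \<open>y\<close> as the image of
  \<open>oct_v0\<close>. The value (z'|y) = -1 gives it norm -1.\<close>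

lemma oct_Aut_transitive_peirce:
  assumes e: "singular_idempotent e" and n: "n \<in> peirce10 e" "n \<noteq> 0"
    and y: "y \<in> peirce01 e" "y \<noteq> 0" and ny: "oct_polar n y = 0"
  shows "\<exists>f\<in>oct_Aut. f oct_p0 = e \<and> f oct_n0 = n \<and> f oct_v0 = y"
proof -
  obtain m where m: "m \<in> peirce01 e" "n * m = e" "m * n = 1 - e"
    using peirce10_matrix_units[OF e n] .
  interpret matrix_units e n m
    by unfold_locales (fact e n m)+
  note ee = singular_idempotent_mult[OF e]
  obtain d where d: "oct_trace (y * d) = 1"
    using ex_trace_mult_one[OF y(2)] .
  \<comment> \<open>The U-part of \<open>d\<close> still satisfies T(zy) = 1, because
    \<open>y * e = y\<close> and \<open>e * y = 0\<close>.\<close>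
  define z where "z = e * d - (e * d) * e"
  have z: "z \<in> peirce10 e"
    by (simp add: peirce10_def z_def oct_mult_more ee oct_alternative(3)[of e d])
      (simp add: ee flip: oct_alternative(3))
  have "oct_trace ((e * d) * y) = oct_trace (y * (e * d))"
    by (rule oct_trace_mult_commute)
  also have "\<dots> = 1"
    using d by (simp add: peirce01D[OF y(1)] flip: oct_trace_mult_assoc)
  finally have "oct_trace (z * y) = 1"
    by (simp add: z_def oct_mult_more oct_polar_more oct_trace_mult_assoc[of _ e y] peirce01D[OF y(1)])
  then have zy: "oct_polar z y = - 1"
    using oct_polar_traceless[of y z] peirce_traceless(2)[OF y(1)] by simp
  \<comment> \<open>The multiple of \<open>n\<close> makes \<open>z'\<close> orthogonal to
    \<open>m\<close>, as (n|m) = -1, and does not change the polar product with \<open>y\<close>, as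
    \<open>n\<close> is orthogonal to \<open>y\<close>.\<close>
  define z' where "z' = z + oct_scale (oct_polar z m) n"
  have z': "z' \<in> peirce10 e"
    using z n by (simp add: peirce10_def z'_def oct_mult_simps)
  have "oct_polar z' m = 0" "oct_polar z' y = - 1"
    by (simp_all add: z'_def oct_polar_simps polars zy ny)
  moreover have "oct_norm z' = 0" "oct_norm y = 0"
    using peirce_singular z' y(1) norms(1) by auto
  ultimately have norm: "oct_norm (z' + y) = - 1"
    and orth: "oct_polar m (z' + y) = 0"
    using peirce01_polar[OF m(1) y(1)]
    by (simp_all add: oct_norm_add oct_polar_more oct_polar_commute[of m z'])
  have "oct_polar n (z' + y) = 0" "oct_polar e (z' + y) = 0" "oct_trace (z' + y) = 0"
    using peirce10_polar[OF n(1) z'] ny peirce_polar_idempotent[of _ e] peirce_traceless[of _ e] z' y(1)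
    by (simp_all add: oct_polar_simps)
  from automorphism[OF this(3,2,1) orth norm]
  obtain f where f: "f \<in> oct_Aut" "\<And>a b c d a' b' c' d'. f (oct8 a b c d a' b' c' d') =
    (oct_scale a e + oct_scale b n + oct_scale c m + oct_scale d (1 - e)) +
    (oct_scale a' e + oct_scale b' n + oct_scale c' m + oct_scale d' (1 - e)) * (z' + y)"
    by blast
  have "(1 - e) * (z' + y) = y"
    using peirce10D[OF z'] peirce01D[OF y(1)] by (simp add: oct_mult_simps)
  then show ?thesis
    using f by (intro bexI[of _ f]) (auto simp: oct8_p0 oct8_n0 oct_mult_more)
qed

lemma oct_nilpotent:
  assumes "n * n = 0"
  shows "oct_norm n = 0" "oct_trace n = 0"
proof -
  have "oct_norm n * oct_norm n = 0"
    using oct_norm_mult[of n n] assms by (simp add: oct8_simps)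
  then show *: "oct_norm n = 0" by simp
  show "oct_trace n = 0"
    using oct_square[of n] assms * by (cases "n = 0") (auto simp: oct_polar_more)
qed

text \<open>If T(nc) = 1, then nc is a singular idempotent whose U contains \<open>n\<close>: (nc)n
  = T(nc)n by \<open>oct_sandwich\<close>, and n(nc) = (nn)c = 0.\<close>

lemma oct_Aut_transitive_nilpotent:
  assumes "n * n = 0" "n \<noteq> 0"
  shows "\<exists>f\<in>oct_Aut. f oct_n0 = n"
proof -
  obtain c where c: "oct_trace (n * c) = 1"
    using ex_trace_mult_one[OF assms(2)] .
  have "singular_idempotent (n * c)"
    using c oct_nilpotent[OF assms(1)] by (simp add: singular_idempotent_def oct_norm_mult)
  moreover have "n \<in> peirce10 (n * c)"
    using c oct_nilpotent[OF assms(1)] oct_sandwich[of n c] assms(1)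
    by (simp add: peirce10_def oct_alternative oct_mult_more)
  ultimately show ?thesis
    using oct_Aut_transitive_peirce10 assms(2) by blast
qed

lemma oct_Aut_transitive_idempotent:
  assumes "singular_idempotent e"
  shows "\<exists>f\<in>oct_Aut. f oct_p0 = e"
  using ex_peirce10[OF assms] oct_Aut_transitive_peirce10[OF assms] by metis

text \<open>After \<open>x\<close> is moved to \<open>oct_n0\<close>, annihilation leaves
  \<open>y\<close> only the coordinates 1, 5, 7, and independence keeps those at 5 and 7 from both
  vanishing.\<close>

lemma oct_Aut_transitive_null_pair:
  assumes null: "x * x = 0" "y * y = 0" "x * y = 0" "y * x = 0"
    and x: "x \<noteq> 0" and y: "\<And>c. y \<noteq> oct_scale c x"
  shows "\<exists>f\<in>oct_Aut. f oct_n0 = x \<and> f oct_v0 = y"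
proof -
  obtain f where f: "f \<in> oct_Aut" "f oct_n0 = x"
    using oct_Aut_transitive_nilpotent[OF null(1) x] by blast
  note D = oct_AutD[OF f(1)]
  have inj: "f u = f v \<Longrightarrow> u = v" for u v
    using D(1) by (meson bij_is_inj injD)
  obtain y' where y': "y = f y'"
    using D(1) by (metis bij_pointE)
  have "oct_n0 * y' = 0" "y' * oct_n0 = 0"
    using null(3,4) by (auto intro!: inj[of _ 0] simp only: D(4) f(2) y' oct_Aut_zero[OF f(1)])
  then obtain b p q where y'_eq: "y' = oct8 0 b 0 0 0 p 0 q"
    by (cases y' rule: oct8_cases) (auto simp: oct8_simps)
  have "p \<noteq> 0 \<or> q \<noteq> 0"
    using y[of b] y' f(2) D(3)[of b oct_n0] by (auto simp: y'_eq oct8_simps)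
  \<comment> \<open>Solves b = ps - qr for \<open>r\<close> and \<open>s\<close>, which is possible
    because \<open>p\<close> or \<open>q\<close> is invertible.\<close>
  then have "b = p * (if p = 0 then 0 else b / p) - q * (if p = 0 then - (b / q) else 0)"
    by auto
  then obtain r s where rs: "b = p * s - q * r"
    by blast
  \<comment> \<open>perturb \<open>p\<^sub>0\<close> so that \<open>y'\<close> lies in \<open>peirce01 e\<close>, not only modulo \<open>n\<^sub>0\<close>\<close>
  define e where "e = oct8 1 0 0 0 0 r 0 s"
  have "singular_idempotent e" "oct_n0 \<in> peirce10 e" "y' \<in> peirce01 e" "oct_polar oct_n0 y' = 0"
    by (simp_all add: singular_idempotent_def peirce10_def peirce01_def e_def y'_eq oct8_simps rs
        algebra_simps)
  moreover have "oct_n0 \<noteq> (0 :: 'a octonion)" "y' \<noteq> 0"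
    using \<open>p \<noteq> 0 \<or> q \<noteq> 0\<close> by (auto simp: y'_eq oct8_simps)
  ultimately obtain g where "g \<in> oct_Aut" "g oct_n0 = oct_n0" "g oct_v0 = y'"
    using oct_Aut_transitive_peirce by blast
  then show ?thesis
    using f y' by (intro bexI[of _ "f \<circ> g"]) (auto intro: oct_Aut_comp)
qed


section \<open>Classification of the totally singular subalgebras\<close>

definition ts_subalgebra :: "'a::field octonion set \<Rightarrow> bool" where
  "ts_subalgebra A \<longleftrightarrow> subalgebra A \<and> totally_singular A"

lemma ts_subalgebraI:
  assumes "oct.subspace A" "\<And>x y. x \<in> A \<Longrightarrow> y \<in> A \<Longrightarrow> x * y \<in> A" "\<And>x. x \<in> A \<Longrightarrow> oct_norm x = 0"
  shows "ts_subalgebra A"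
  using assms oct.subspace_0[of A] by (force simp: ts_subalgebra_def subalgebra_def totally_singular_def)

lemma ts_subalgebraD:
  assumes "ts_subalgebra A"
  shows "oct.subspace A" "\<And>x y. x \<in> A \<Longrightarrow> y \<in> A \<Longrightarrow> x * y \<in> A" "\<And>x. x \<in> A \<Longrightarrow> oct_norm x = 0"
    "\<And>x y. x \<in> A \<Longrightarrow> y \<in> A \<Longrightarrow> oct_polar x y = 0"
proof -
  show sub: "oct.subspace A" and "\<And>x y. x \<in> A \<Longrightarrow> y \<in> A \<Longrightarrow> x * y \<in> A"
    and norm: "\<And>x. x \<in> A \<Longrightarrow> oct_norm x = 0"
    using assms by (auto simp: ts_subalgebra_def subalgebra_def totally_singular_def)
  show "oct_polar x y = 0" if "x \<in> A" "y \<in> A" for x y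
    using that norm oct.subspace_add[OF sub] by (simp add: oct_polar_def)
qed

text \<open>Lets \<open>A\<close> be studied in standard coordinates: membership in the preimage
  unfolds to \<open>f u \<in> A\<close>, so the given elements of \<open>A\<close> remain
  usable.\<close>

lemma ts_subalgebra_vimage:
  assumes f: "f \<in> oct_Aut" and A: "ts_subalgebra A"
  shows "ts_subalgebra (f -` A)"
proof -
  note closed = ts_subalgebraD[OF A]
  have "oct_norm u = 0" if "f u \<in> A" for u
    using closed(3)[OF that] by (simp add: oct_Aut_norm[OF f])
  then show ?thesis
    using closed(2) oct.subspace_0[OF closed(1)] oct.subspace_add[OF closed(1)] oct.subspace_scale[OF closed(1)]
    by (intro ts_subalgebraI oct.subspaceI) (simp_all add: oct_AutD[OF f] oct_Aut_zero[OF f])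
qed

lemma oct_Aut_inj:
  assumes "f \<in> oct_Aut"
  shows "f u = f v \<longleftrightarrow> u = v"
  using oct_AutD(1)[OF assms] by (meson bij_is_inj inj_eq)

lemma oct_Aut_surj:
  assumes "f \<in> oct_Aut"
  obtains u where "v = f u"
  using oct_AutD(1)[OF assms] by (metis bij_pointE)

section \<open>Orbits as equivalence classes\<close>

lemma mem_oct_orbit_vimage:
  assumes "f \<in> oct_Aut" "f -` A = B"
  shows "A \<in> oct_orbit B"
proof -
  have "A = f ` B"
    using assms oct_AutD(1)[OF assms(1)] by (simp add: bij_is_surj surj_image_vimage_eq flip: assms(2))
  with assms(1) show ?thesis
    by (auto simp: oct_orbit_def)
qed

lemma mem_oct_orbit_trans:
  assumes "A \<in> oct_orbit B" "B \<in> oct_orbit C"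
  shows "A \<in> oct_orbit C"
proof -
  obtain f g where "f \<in> oct_Aut" "g \<in> oct_Aut" "A = (f \<circ> g) ` C"
    using assms by (auto simp: oct_orbit_def image_comp)
  then show ?thesis
    using oct_Aut_comp unfolding oct_orbit_def by blast
qed

lemma mem_oct_orbit_refl: "A \<in> oct_orbit A"
  unfolding oct_orbit_def by (rule image_eqI[OF _ oct_Aut_id]) simp

lemma mem_oct_orbit_sym:
  assumes "A \<in> oct_orbit B"
  shows "B \<in> oct_orbit A"
proof -
  obtain f where f: "f \<in> oct_Aut" "A = f ` B"
    using assms by (auto simp: oct_orbit_def)
  then have "B = inv f ` A"
    using oct_AutD(1)[OF f(1)] by (simp add: bij_is_inj image_inv_f_f)
  with f(1) show ?thesis
    using oct_Aut_inv by (auto simp: oct_orbit_def)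
qed

lemma oct_orbit_eq_iff: "oct_orbit A = oct_orbit B \<longleftrightarrow> A \<in> oct_orbit B"
proof
  show "oct_orbit A = oct_orbit B \<Longrightarrow> A \<in> oct_orbit B"
    using mem_oct_orbit_refl[of A] by simp
  show "A \<in> oct_orbit B \<Longrightarrow> oct_orbit A = oct_orbit B"
    using mem_oct_orbit_trans mem_oct_orbit_sym by blast
qed

lemma coord_space_subset:
  "oct.subspace A \<Longrightarrow> oct_unit ` I \<subseteq> A \<Longrightarrow> coord_space I \<subseteq> A"
  unfolding coord_space_def by (rule oct.span_minimal)

section \<open>The images nO and On in coordinates\<close>

lemma oct_unit_simps:
  "oct_unit 0 = oct8 1 0 0 0 0 0 0 0" "oct_unit 1 = oct8 0 1 0 0 0 0 0 0"
  "oct_unit (Suc 0) = oct8 0 1 0 0 0 0 0 0"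
  "oct_unit 2 = oct8 0 0 1 0 0 0 0 0" "oct_unit 3 = oct8 0 0 0 1 0 0 0 0"
  "oct_unit 4 = oct8 0 0 0 0 1 0 0 0" "oct_unit 5 = oct8 0 0 0 0 0 1 0 0"
  "oct_unit 6 = oct8 0 0 0 0 0 0 1 0" "oct_unit 7 = oct8 0 0 0 0 0 0 0 1"
  by (simp_all add: oct_unit_def)

lemma left_mult_image_n0: "left_mult_image oct_n0 = (coord_space {0, 1, 5, 7} :: 'a::field octonion set)"
proof (rule set_eqI)
  fix u :: "'a octonion"
  show "u \<in> left_mult_image oct_n0 \<longleftrightarrow> u \<in> coord_space {0, 1, 5, 7}"
  proof (cases u rule: oct8_cases)
    case (oct8 a b c d e f g h)
    \<comment> \<open>The second factor is a preimage of \<open>u\<close> read off from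
      \<open>oct8_mult\<close>.\<close>
    then have "u \<in> coord_space {0, 1, 5, 7} \<Longrightarrow> u = oct_n0 * oct8 0 0 a b f 0 h 0"
      by (simp add: mem_coord_space oct8_simps)
    moreover have "oct_n0 * v \<in> coord_space {0, 1, 5, 7}" for v :: "'a octonion"
      by (cases v rule: oct8_cases) (simp add: mem_coord_space oct8_simps)
    ultimately show ?thesis
      by (auto simp: left_mult_image_def)
  qed
qed

lemma right_mult_image_n0: "right_mult_image oct_n0 = (coord_space {1, 3, 5, 7} :: 'a::field octonion set)"
proof (rule set_eqI)
  fix u :: "'a octonion"
  show "u \<in> right_mult_image oct_n0 \<longleftrightarrow> u \<in> coord_space {1, 3, 5, 7}"
  proof (cases u rule: oct8_cases)
    case (oct8 a b c d e f g h)
    then have "u \<in> coord_space {1, 3, 5, 7} \<Longrightarrow> u = oct8 b 0 d 0 (- f) 0 (- h) 0 * oct_n0"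
      by (simp add: mem_coord_space oct8_simps)
    moreover have "v * oct_n0 \<in> coord_space {1, 3, 5, 7}" for v :: "'a octonion"
      by (cases v rule: oct8_cases) (simp add: mem_coord_space oct8_simps)
    ultimately show ?thesis
      by (auto simp: right_mult_image_def)
  qed
qed

lemma right_mult_image_v0: "right_mult_image oct_v0 = (coord_space {0, 1, 6, 7} :: 'a::field octonion set)"
proof (rule set_eqI)
  fix u :: "'a octonion"
  show "u \<in> right_mult_image oct_v0 \<longleftrightarrow> u \<in> coord_space {0, 1, 6, 7}"
  proof (cases u rule: oct8_cases)
    case (oct8 a b c d e f g h)
    then have "u \<in> coord_space {0, 1, 6, 7} \<Longrightarrow> u = oct8 0 0 g h a b 0 0 * oct_v0"
      by (simp add: mem_coord_space oct8_simps)
    moreover have "v * oct_v0 \<in> coord_space {0, 1, 6, 7}" for v :: "'a octonion"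
      by (cases v rule: oct8_cases) (simp add: mem_coord_space oct8_simps)
    ultimately show ?thesis
      by (auto simp: right_mult_image_def)
  qed
qed

lemma left_mult_image_v0: "left_mult_image oct_v0 = (coord_space {1, 3, 6, 7} :: 'a::field octonion set)"
proof (rule set_eqI)
  fix u :: "'a octonion"
  show "u \<in> left_mult_image oct_v0 \<longleftrightarrow> u \<in> coord_space {1, 3, 6, 7}"
  proof (cases u rule: oct8_cases)
    case (oct8 a b c d e f g h)
    then have "u \<in> coord_space {1, 3, 6, 7} \<Longrightarrow> u = oct_v0 * oct8 h 0 (- g) 0 d (- b) 0 0"
      by (simp add: mem_coord_space oct8_simps)
    moreover have "oct_v0 * v \<in> coord_space {1, 3, 6, 7}" for v :: "'a octonion"
      by (cases v rule: oct8_cases) (simp add: mem_coord_space oct8_simps)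
    ultimately show ?thesis
      by (auto simp: left_mult_image_def)
  qed
qed

lemma oct_Aut_mult_image:
  assumes "f \<in> oct_Aut"
  shows "f ` left_mult_image n = left_mult_image (f n)"
    and "f ` right_mult_image n = right_mult_image (f n)"
  using oct_AutD(1)[OF assms] bij_is_surj[of f]
  by (auto simp: left_mult_image_def right_mult_image_def oct_AutD[OF assms] image_comp comp_def
      elim!: oct_Aut_surj[OF assms]) (metis oct_AutD(4)[OF assms] oct_Aut_surj[OF assms] rangeI)+

lemma oct_Aut_n0:
  fixes f :: "'a::field octonion \<Rightarrow> 'a octonion"
  assumes "f \<in> oct_Aut"
  shows "f oct_n0 * f oct_n0 = 0" "f oct_n0 \<noteq> 0"
proof -
  have "oct_n0 * oct_n0 = (0 :: 'a octonion)" "oct_n0 \<noteq> (0 :: 'a octonion)"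
    by (simp_all add: oct8_simps)
  then show "f oct_n0 * f oct_n0 = 0" "f oct_n0 \<noteq> 0"
    using oct_Aut_inj[OF assms, of oct_n0 0]
    by (simp_all add: oct_Aut_zero[OF assms] flip: oct_AutD(4)[OF assms])
qed

text \<open>An automorphism carries nO to f(n)O, and automorphisms are transitive on the non-zero
  elements of square zero.\<close>

lemma oct_orbit_left_mult_image_n0:
  "oct_orbit (left_mult_image (oct_n0 :: 'a::field octonion)) = {left_mult_image n | n. n * n = 0 \<and> n \<noteq> 0}"
  using oct_Aut_n0 oct_Aut_transitive_nilpotent
  by (fastforce simp: oct_orbit_def oct_Aut_mult_image)

lemma oct_orbit_right_mult_image_n0:
  "oct_orbit (right_mult_image (oct_n0 :: 'a::field octonion)) = {right_mult_image n | n. n * n = 0 \<and> n \<noteq> 0}"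
  using oct_Aut_n0 oct_Aut_transitive_nilpotent
  by (fastforce simp: oct_orbit_def oct_Aut_mult_image)

text \<open>After \<open>0\<close>, the two lines, and the planes with left identity, right identity and trivial
  multiplication come \<open>n\<^sub>0O \<inter> Ov\<^sub>0\<close>, \<open>n\<^sub>0O \<inter> On\<^sub>0\<close>, \<open>n\<^sub>0O\<close> and \<open>On\<^sub>0\<close>.\<close>

definition normal_indices :: "nat set set" where
  "normal_indices =
     {{}, {0}, {1}, {0, 1}, {1, 3}, {1, 7}, {0, 1, 7}, {1, 5, 7}, {0, 1, 5, 7}, {1, 3, 5, 7}}"

definition ts_normal_forms :: "'a::field octonion set set" where
  "ts_normal_forms = coord_space ` normal_indices"


subsection \<open>Subalgebras of trace zero\<close>

text \<open>The two-sided annihilator of \<open>oct_n0\<close> is the Heisenberg normal form, so it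
  bounds every subalgebra that annihilates a nilpotent element.\<close>

lemma n0_annihilator:
  assumes "oct_n0 * u = 0" "u * oct_n0 = 0"
  obtains b f h where "u = oct8 0 b 0 0 0 f 0 h"
  using assms by (cases u rule: oct8_cases) (auto simp: oct8_simps)

locale nil_ts_subalgebra =
  fixes A :: "'a::field octonion set"
  assumes ts: "ts_subalgebra A" and nil: "x \<in> A \<Longrightarrow> oct_trace x = 0"
begin

lemmas closed = ts_subalgebraD[OF ts]

lemma square: "x \<in> A \<Longrightarrow> x * x = 0"
  using oct_square[of x] closed(3) nil by simp

text \<open>On \<open>A\<close> conjugation is negation and the polar form vanishes, so
  \<open>oct_conj_scalar\<close> becomes xy + yx = 0.\<close>

lemma anticommute: "x \<in> A \<Longrightarrow> y \<in> A \<Longrightarrow> y * x = - (x * y)"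
  using oct_conj_scalar[of x y] closed(4)[of x y] nil
  by (simp add: oct_conj_traceless oct_mult_more minus_equation_iff eq_neg_iff_add_eq_0 algebra_simps)

lemma left_square: "x \<in> A \<Longrightarrow> x * (x * u) = 0"
  by (simp add: oct_alternative square oct_mult_more)

lemma left_swap: "x \<in> A \<Longrightarrow> y \<in> A \<Longrightarrow> x * (y * u) = - (y * (x * u))"
  using oct_left_alternative_lin[of x y u] anticommute[of x y]
  by (simp add: oct_mult_more eq_neg_iff_add_eq_0)

text \<open>If \<open>t = z(xy)\<close> were non-zero, then \<open>t\<close> would annihilate \<open>x\<close> and \<open>y\<close>; but products of annihilators
  of \<open>t\<close> are multiples of \<open>t\<close>, and \<open>zt = 0\<close>.\<close>

lemma mult_product_eq_zero:
  assumes "x \<in> A" "y \<in> A" "z \<in> A"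
  shows "z * (x * y) = 0"
proof (rule ccontr)
  define t where "t = z * (x * y)"
  assume "z * (x * y) \<noteq> 0"
  then have t: "t \<in> A" "t \<noteq> 0"
    using assms closed(2) by (auto simp: t_def)
  have "t = - (x * (z * y))"
    unfolding t_def using left_swap assms by blast
  then have xt: "x * t = 0"
    using left_square[OF assms(1)] by (simp add: oct_mult_more)
  \<comment> \<open>Anticommutativity of the inner product followed by a swap brings
    \<open>y\<close> to the front; the two signs cancel.\<close>
  have "t = y * (z * x)"
    unfolding t_def using left_swap[of y z x] anticommute[of y x] assms by (simp add: oct_mult_more)
  then have yt: "y * t = 0"
    using left_square[OF assms(2)] by simp
  have zt: "z * t = 0"
    unfolding t_def using left_square[OF assms(3)] .
  obtain f where f: "f \<in> oct_Aut" "f oct_n0 = t"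
    using oct_Aut_transitive_nilpotent square t by blast
  note D = oct_AutD[OF f(1)] oct_Aut_zero[OF f(1)] oct_Aut_inj[OF f(1)]
  obtain x' y' where xy: "x = f x'" "y = f y'"
    by (metis oct_Aut_surj[OF f(1)])
  have "f (oct_n0 * x') = f 0" "f (x' * oct_n0) = f 0" "f (oct_n0 * y') = f 0" "f (y' * oct_n0) = f 0"
    using xt yt anticommute[OF assms(1) t(1)] anticommute[OF assms(2) t(1)]
    by (simp_all add: D(4,5) f(2) flip: xy)
  then have "oct_n0 * x' = 0" "x' * oct_n0 = 0" "oct_n0 * y' = 0" "y' * oct_n0 = 0"
    by (simp_all add: D(6))
  then obtain k where "x' * y' = oct_scale k oct_n0"
    by (elim n0_annihilator) (auto simp: oct8_simps)
  then have "x * y = oct_scale k t"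
    by (simp add: xy flip: D(4) f(2) D(3))
  then have "z * (x * y) = 0"
    by (simp only: oct_mult_bilinear zt oct.scale_zero_right)
  with t(2) show False
    by (simp add: t_def)
qed

text \<open>Since \<open>A\<close> annihilates xy, its preimage lies in the annihilator of
  \<open>oct_n0\<close>. Equality holds because the preimages of \<open>x\<close>, \<open>y\<close>
  and xy already span that space.\<close>

lemma orbit_heisenberg:
  assumes "x \<in> A" "y \<in> A" "x * y \<noteq> 0"
  shows "A \<in> oct_orbit (coord_space {1, 5, 7})"
proof -
  define n where "n = x * y"
  have n: "n \<in> A" "n \<noteq> 0"
    using assms closed by (auto simp: n_def)
  obtain f where f: "f \<in> oct_Aut" "f oct_n0 = n"
    using oct_Aut_transitive_nilpotent square n by blast
  note D = oct_AutD[OF f(1)] oct_Aut_zero[OF f(1)] oct_Aut_inj[OF f(1)]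
  note sub = ts_subalgebraD(1)[OF ts_subalgebra_vimage[OF f(1) ts]]
  have ann: "\<exists>b p q. u = oct8 0 b 0 0 0 p 0 q" if "f u \<in> A" for u
  proof -
    have "f u * n = 0"
      using mult_product_eq_zero[OF assms(1,2) that] by (simp add: n_def)
    moreover have "n * f u = 0"
      using anticommute[OF that n(1)] calculation by simp
    ultimately have "f (u * oct_n0) = f 0" "f (oct_n0 * u) = f 0"
      by (simp_all add: D(4,5) f(2))
    then show ?thesis
      unfolding D(6) by (elim n0_annihilator) auto
  qed
  obtain x' y' where xy: "x = f x'" "y = f y'"
    by (metis oct_Aut_surj[OF f(1)])
  obtain b p q b' p' q' where x': "x' = oct8 0 b 0 0 0 p 0 q" and y': "y' = oct8 0 b' 0 0 0 p' 0 q'"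
    using ann assms xy by metis
  have "f (x' * y') = f oct_n0"
    by (simp add: D(4) f(2) n_def xy)
  then have det: "p * q' - q * p' = 1"
    by (simp add: D(6) x' y' oct8_simps algebra_simps)
  have "oct8 0 k 0 0 0 r 0 s \<in> f -` A" for k r s
  proof -
    \<comment> \<open>Cramer's rule for the coordinates 5 and 7, with determinant 1; the third
      coefficient corrects coordinate 1.\<close>
    have "oct_scale (r * q' - s * p') x' + oct_scale (p * s - q * r) y'
        + oct_scale (k - (r * q' - s * p') * b - (p * s - q * r) * b') oct_n0
      = oct8 0 k 0 0 0 (r * (p * q' - q * p')) 0 (s * (p * q' - q * p'))"
      by (simp add: x' y' oct8_simps algebra_simps)
    also have "\<dots> = oct8 0 k 0 0 0 r 0 s"
      by (simp add: det)
    finally show ?thesis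
      using assms n xy f(2)
      by (metis oct.subspace_add oct.subspace_scale sub vimageI2)
  qed
  then have "f -` A = coord_space {1, 5, 7}"
    using ann by (intro equalityI subsetI; rule_tac u = x in oct8_cases) (force simp: mem_coord_space)+
  with f(1) show ?thesis
    by (rule mem_oct_orbit_vimage)
qed

text \<open>Two independent elements can be moved to \<open>oct_n0\<close> and
  \<open>oct_v0\<close>. Every element annihilated by both is a combination of them, so dimension 3
  cannot occur.\<close>

lemma orbit_trivial_mult:
  assumes trivial: "\<And>x y. x \<in> A \<Longrightarrow> y \<in> A \<Longrightarrow> x * y = 0"
  shows "\<exists>I\<in>{{}, {1}, {1, 7}}. A \<in> oct_orbit (coord_space I)"
proof -
  consider "A = {0}" | x where "x \<in> A" "x \<noteq> 0" "A \<subseteq> range (\<lambda>c. oct_scale c x)"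
    | x y where "x \<in> A" "x \<noteq> 0" "y \<in> A" "\<And>c. y \<noteq> oct_scale c x"
    using oct.subspace_0[OF closed(1)] by fast
  then show ?thesis
  proof cases
    case 1
    then have "A = coord_space {}"
      by (simp add: coord_space_def)
    then show ?thesis
      using mem_oct_orbit_refl by blast
  next
    case 2
    then obtain f where f: "f \<in> oct_Aut" "f oct_n0 = x"
      using oct_Aut_transitive_nilpotent square by blast
    have "f -` A = coord_space {1}"
    proof
      show "coord_space {1} \<subseteq> f -` A"
        using ts_subalgebraD(1)[OF ts_subalgebra_vimage[OF f(1) ts]] f(2) 2(1)
        by (intro coord_space_subset) (auto simp: oct_unit_simps oct8_simps)
      show "f -` A \<subseteq> coord_space {1}"
      proof
        fix u assume "u \<in> f -` A"
        then obtain c where "f u = f (oct_scale c oct_n0)"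
          using 2(3) by (auto simp: oct_AutD[OF f(1)] f(2))
        then have "u = oct_scale c oct_n0"
          by (simp only: oct_Aut_inj[OF f(1)])
        then show "u \<in> coord_space {1}"
          by (simp add: mem_coord_space oct8_simps)
      qed
    qed
    then show ?thesis
      using mem_oct_orbit_vimage[OF f(1)] by blast
  next
    case 3
    then obtain f where f: "f \<in> oct_Aut" "f oct_n0 = x" "f oct_v0 = y"
      using oct_Aut_transitive_null_pair[of x y] trivial by blast
    note D = oct_AutD[OF f(1)] oct_Aut_zero[OF f(1)] oct_Aut_inj[OF f(1)]
    have "f -` A = coord_space {1, 7}"
    proof
      show "coord_space {1, 7} \<subseteq> f -` A"
        using ts_subalgebraD(1)[OF ts_subalgebra_vimage[OF f(1) ts]] f(2,3) 3(1,3)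
        by (intro coord_space_subset) (auto simp: oct_unit_simps oct8_simps)
      show "f -` A \<subseteq> coord_space {1, 7}"
      proof
        fix u assume u: "u \<in> f -` A"
        have "f (oct_n0 * u) = f 0" "f (u * oct_n0) = f 0" "f (u * oct_v0) = f 0"
          using trivial u 3 by (simp_all add: D(4,5) f)
        then have "oct_n0 * u = 0" "u * oct_n0 = 0" "u * oct_v0 = 0"
          by (simp_all add: D(6))
        then show "u \<in> coord_space {1, 7}"
          by (elim n0_annihilator) (auto simp: mem_coord_space oct8_simps)
      qed
    qed
    then show ?thesis
      using mem_oct_orbit_vimage[OF f(1)] by blast
  qed
qed

lemma classification: "\<exists>X\<in>ts_normal_forms. A \<in> oct_orbit X"
proof -
  have "\<exists>I\<in>{{}, {1}, {1, 7}, {1, 5, 7}}. A \<in> oct_orbit (coord_space I)"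
  proof (cases "\<exists>x\<in>A. \<exists>y\<in>A. x * y \<noteq> 0")
    case True
    then have "A \<in> oct_orbit (coord_space {1, 5, 7})"
      using orbit_heisenberg by auto
    then show ?thesis by simp
  next
    case False
    then have "\<exists>I\<in>{{}, {1}, {1, 7}}. A \<in> oct_orbit (coord_space I)"
      by (intro orbit_trivial_mult) auto
    then show ?thesis by auto
  qed
  then obtain I where I: "I \<in> {{}, {1}, {1, 7}, {1, 5, 7}}" "A \<in> oct_orbit (coord_space I)"
    by (elim bexE)
  from I(1) have "I \<in> normal_indices"
    unfolding normal_indices_def by (elim insertE emptyE) simp_all
  with I(2) show ?thesis
    unfolding ts_normal_forms_def by (intro bexI[OF _ imageI])
qed

end


subsection \<open>Subalgebras containing an idempotent\<close>

text \<open>With \<open>e\<close> and \<open>x\<close> moved to \<open>oct_p0\<close> and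
  \<open>oct_n0\<close>, left multiplication by \<open>oct_n0\<close> exhibits exactly the two
  coordinates of U outside the line of \<open>oct_n0\<close>. In effect the product on U is a cross
  product.\<close>

lemma peirce10_parallel:
  assumes "singular_idempotent e" "x \<in> peirce10 e" "u \<in> peirce10 e" "x \<noteq> 0" "x * u = 0"
  obtains c where "u = oct_scale c x"
proof -
  obtain f where f: "f \<in> oct_Aut" "f oct_p0 = e" "f oct_n0 = x"
    using oct_Aut_transitive_peirce10[OF assms(1,2,4)] by blast
  note D = oct_AutD[OF f(1)] oct_Aut_zero[OF f(1)] oct_Aut_inj[OF f(1)]
  obtain u' where u': "u = f u'"
    by (metis oct_Aut_surj[OF f(1)])
  have "f (oct_p0 * u') = f u'" "f (u' * oct_p0) = f 0" "f (oct_n0 * u') = f 0"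
    using assms by (simp_all add: D(4,5) f(2,3) peirce10D flip: u')
  then have "oct_p0 * u' = u'" "u' * oct_p0 = 0" "oct_n0 * u' = 0"
    by (simp_all only: D(6))
  then have "\<exists>c. u' = oct_scale c oct_n0"
    by (cases u' rule: oct8_cases) (auto simp: oct8_simps)
  then show thesis
    using that f(3) u' D(3) by metis
qed

lemma mem_peirce_p0:
  "oct8 a b c d e f g h \<in> peirce10 oct_p0 \<longleftrightarrow> a = 0 \<and> c = 0 \<and> d = 0 \<and> f = 0 \<and> h = 0"
  "oct8 a b c d e f g h \<in> peirce01 oct_p0 \<longleftrightarrow> a = 0 \<and> b = 0 \<and> d = 0 \<and> e = 0 \<and> g = 0"
  by (auto simp: peirce10_def peirce01_def oct8_simps)

abbreviation oct_p1 :: "'a::field octonion" where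
  "oct_p1 \<equiv> oct8 0 0 0 1 0 0 0 0"

text \<open>Replacing \<open>oct_p0\<close> by its complementary idempotent exchanges U and V, so
  results proved for U also serve for V.\<close>

lemma peirce_p1:
  "peirce10 oct_p1 = peirce01 (oct_p0 :: 'a::field octonion)"
  "peirce01 oct_p1 = peirce10 (oct_p0 :: 'a::field octonion)"
proof -
  have "u \<in> peirce10 oct_p1 \<longleftrightarrow> u \<in> peirce01 oct_p0" "u \<in> peirce01 oct_p1 \<longleftrightarrow> u \<in> peirce10 oct_p0"
    for u :: "'a octonion"
    by (cases u rule: oct8_cases; auto simp: peirce10_def peirce01_def oct8_simps)+
  then show "peirce10 oct_p1 = peirce01 (oct_p0 :: 'a octonion)"
    "peirce01 oct_p1 = peirce10 (oct_p0 :: 'a octonion)"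
    by blast+
qed

lemma singular_idempotent_p: "singular_idempotent oct_p0" "singular_idempotent oct_p1"
  by (simp_all add: singular_idempotent_def oct8_simps)

lemma oct_Aut_p1:
  assumes "f \<in> oct_Aut"
  shows "f oct_p1 = 1 - f oct_p0"
proof -
  have "f oct_p1 + f oct_p0 = f 1"
    by (simp add: oct8_simps flip: oct_AutD(2)[OF assms])
  then show ?thesis
    by (simp add: oct_Aut_one[OF assms] eq_diff_eq)
qed

locale p0_ts_subalgebra =
  fixes A :: "'a::field octonion set"
  assumes ts: "ts_subalgebra A" and p0: "oct_p0 \<in> A"
begin

lemmas closed = ts_subalgebraD[OF ts]

lemma decompose:
  assumes "z \<in> A"
  obtains a u v where "u \<in> A" "u \<in> peirce10 oct_p0" "v \<in> A" "v \<in> peirce01 oct_p0"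
    "z = oct_scale a oct_p0 + u + v"
proof -
  obtain a b c d e f g h where z: "z = oct8 a b c d e f g h"
    by (rule oct8_cases)
  \<comment> \<open>Coordinate 3 is the polar product with \<open>oct_p0\<close>, which lies in
    \<open>A\<close>.\<close>
  have "d = 0"
    using closed(4)[OF assms p0] by (simp add: z oct8_simps)
  then have "z = oct_scale a oct_p0 + oct8 0 b 0 0 e 0 g 0 + oct8 0 0 c 0 0 f 0 h"
    by (simp add: z oct8_simps)
  \<comment> \<open>Both Peirce parts are differences of products of \<open>z\<close> with
    \<open>oct_p0\<close>, so they stay in \<open>A\<close>.\<close>
  moreover have "oct8 0 b 0 0 e 0 g 0 = oct_p0 * z - (oct_p0 * z) * oct_p0"
    "oct8 0 0 c 0 0 f 0 h = z * oct_p0 - (oct_p0 * z) * oct_p0"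
    by (simp_all add: z oct8_simps)
  then have "oct8 0 b 0 0 e 0 g 0 \<in> A" "oct8 0 0 c 0 0 f 0 h \<in> A"
    using closed(1,2) p0 assms by (simp_all add: oct.subspace_diff)
  ultimately show thesis
    by (intro that[of "oct8 0 b 0 0 e 0 g 0" "oct8 0 0 c 0 0 f 0 h" a]) (simp_all add: mem_peirce_p0)
qed

text \<open>A non-zero product on \<open>A \<inter> U\<close> determines \<open>A\<close>: once
  \<open>oct_p0\<close>, \<open>x\<close> and xy are in standard position, \<open>y\<close> is known
  modulo \<open>x\<close>. Orthogonality to the resulting four units, one from each polar pair,
  removes the other four coordinates.\<close>

lemma orbit_right_mult_image:
  assumes x: "x \<in> A" "x \<in> peirce10 oct_p0" and y: "y \<in> A" "y \<in> peirce10 oct_p0" and xy: "x * y \<noteq> 0"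
  shows "A \<in> oct_orbit (coord_space {1, 3, 5, 7})"
proof -
  have "x * y \<in> peirce01 oct_p0"
    using x(2) y(2) by (cases x rule: oct8_cases; cases y rule: oct8_cases)
      (simp add: mem_peirce_p0 oct8_mult)
  moreover have "oct_polar x (x * y) = 0"
    using closed x y by simp
  moreover have "x \<noteq> 0"
    using xy by (auto simp: oct_mult_more)
  ultimately obtain f where f: "f \<in> oct_Aut" "f oct_p0 = oct_p0" "f oct_n0 = x" "f oct_v0 = x * y"
    using oct_Aut_transitive_peirce[OF singular_idempotent_p(1) x(2)] xy by blast
  note D = oct_AutD[OF f(1)] oct_Aut_zero[OF f(1)] oct_Aut_inj[OF f(1)]
  note closed' = ts_subalgebraD[OF ts_subalgebra_vimage[OF f(1) ts]]
  obtain y' where y': "y = f y'"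
    by (metis oct_Aut_surj[OF f(1)])
  have "f (oct_p0 * y') = f y'" "f (y' * oct_p0) = f 0" "f (oct_n0 * y') = f oct_v0"
    using y(2) by (simp_all add: D(4,5) f peirce10D flip: y')
  then have "oct_p0 * y' = y'" "y' * oct_p0 = 0" "oct_n0 * y' = oct_v0"
    by (simp_all only: D(6))
  \<comment> \<open>The product with \<open>oct_n0\<close> fixes coordinates 4 and 6 of
    \<open>y'\<close>; only its \<open>oct_n0\<close> part stays free.\<close>
  then obtain b where b: "y' = oct8 0 b 0 0 0 0 1 0"
    by (cases y' rule: oct8_cases) (auto simp: oct8_simps)
  have mem: "oct_p0 \<in> f -` A" "oct_n0 \<in> f -` A" "oct_v0 \<in> f -` A"
    using f p0 x y closed(2) by auto
  moreover have "y' - oct_scale b oct_n0 \<in> f -` A"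
    using closed'(1) mem(2) y(1) y' by (intro oct.subspace_diff oct.subspace_scale) auto
  ultimately have units: "oct8 1 0 0 0 0 0 0 0 \<in> f -` A" "oct8 0 1 0 0 0 0 0 0 \<in> f -` A"
    "oct8 0 0 0 0 0 0 1 0 \<in> f -` A" "oct_v0 \<in> f -` A"
    by (auto simp: b oct8_simps)
  have "f -` A = coord_space {0, 1, 6, 7}"
  proof
    show "coord_space {0, 1, 6, 7} \<subseteq> f -` A"
      using closed'(1) units by (intro coord_space_subset) (simp_all add: oct_unit_simps)
    show "f -` A \<subseteq> coord_space {0, 1, 6, 7}"
    proof
      fix u assume u: "u \<in> f -` A"
      note orth = units[THEN closed'(4)[OF u]]
      show "u \<in> coord_space {0, 1, 6, 7}"
        using orth by (cases u rule: oct8_cases) (simp add: mem_coord_space oct8_polar)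
    qed
  qed
  then have "A \<in> oct_orbit (right_mult_image oct_v0)"
    unfolding right_mult_image_v0 by (rule mem_oct_orbit_vimage[OF f(1)])
  \<comment> \<open>The indices 0, 1, 6, 7 describe another member of the orbit of the chosen normal
    form, since \<open>oct_v0\<close> also is nilpotent.\<close>
  moreover have "right_mult_image oct_v0 \<in> oct_orbit (right_mult_image (oct_n0 :: 'a octonion))"
    unfolding oct_orbit_right_mult_image_n0 by (auto simp: oct8_simps intro!: exI[of _ "oct_v0"])
  ultimately show ?thesis
    using mem_oct_orbit_trans by (simp add: right_mult_image_n0)
qed

text \<open>The mirror image of \<open>orbit_right_mult_image\<close>, with \<open>oct_p1\<close> in
  place of \<open>oct_p0\<close>: a non-zero product on \<open>A \<inter> V\<close> leads to nO
  instead of On.\<close>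

lemma orbit_left_mult_image:
  assumes x: "x \<in> A" "x \<in> peirce01 oct_p0" and y: "y \<in> A" "y \<in> peirce01 oct_p0" and xy: "x * y \<noteq> 0"
  shows "A \<in> oct_orbit (coord_space {0, 1, 5, 7})"
proof -
  have "x * y \<in> peirce10 oct_p0"
    using x(2) y(2) by (cases x rule: oct8_cases; cases y rule: oct8_cases)
      (simp add: mem_peirce_p0 oct8_mult)
  moreover have "oct_polar x (x * y) = 0"
    using closed x y by simp
  moreover have "x \<noteq> 0"
    using xy by (auto simp: oct_mult_more)
  ultimately obtain f where f: "f \<in> oct_Aut" "f oct_p0 = oct_p1" "f oct_n0 = x" "f oct_v0 = x * y"
    using oct_Aut_transitive_peirce[OF singular_idempotent_p(2)] x(2) xy by (auto simp: peirce_p1)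
  note D = oct_AutD[OF f(1)] oct_Aut_zero[OF f(1)] oct_Aut_inj[OF f(1)]
  note closed' = ts_subalgebraD[OF ts_subalgebra_vimage[OF f(1) ts]]
  obtain y' where y': "y = f y'"
    by (metis oct_Aut_surj[OF f(1)])
  have "f (oct_p0 * y') = f y'" "f (y' * oct_p0) = f 0" "f (oct_n0 * y') = f oct_v0"
    using y(2) unfolding peirce_p1[symmetric] by (simp_all add: D(4,5) f peirce10D flip: y')
  then have "oct_p0 * y' = y'" "y' * oct_p0 = 0" "oct_n0 * y' = oct_v0"
    by (simp_all only: D(6))
  then obtain b where b: "y' = oct8 0 b 0 0 0 0 1 0"
    by (cases y' rule: oct8_cases) (auto simp: oct8_simps)
  have "f oct_p1 = oct_p0"
    by (simp add: oct_Aut_p1[OF f(1)] f(2)) (simp add: oct8_simps)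
  then have mem: "oct_p1 \<in> f -` A" "oct_n0 \<in> f -` A" "oct_v0 \<in> f -` A"
    using f p0 x y closed(2) by auto
  moreover have "y' - oct_scale b oct_n0 \<in> f -` A"
    using closed'(1) mem(2) y(1) y' by (intro oct.subspace_diff oct.subspace_scale) auto
  ultimately have units: "oct_p1 \<in> f -` A" "oct8 0 1 0 0 0 0 0 0 \<in> f -` A"
    "oct8 0 0 0 0 0 0 1 0 \<in> f -` A" "oct_v0 \<in> f -` A"
    by (auto simp: b oct8_simps)
  have "f -` A = coord_space {1, 3, 6, 7}"
  proof
    show "coord_space {1, 3, 6, 7} \<subseteq> f -` A"
      using closed'(1) units by (intro coord_space_subset) (simp_all add: oct_unit_simps)
    show "f -` A \<subseteq> coord_space {1, 3, 6, 7}"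
    proof
      fix u assume u: "u \<in> f -` A"
      note orth = units[THEN closed'(4)[OF u]]
      show "u \<in> coord_space {1, 3, 6, 7}"
        using orth by (cases u rule: oct8_cases) (simp add: mem_coord_space oct8_polar)
    qed
  qed
  then have "A \<in> oct_orbit (left_mult_image oct_v0)"
    unfolding left_mult_image_v0 by (rule mem_oct_orbit_vimage[OF f(1)])
  moreover have "left_mult_image oct_v0 \<in> oct_orbit (left_mult_image (oct_n0 :: 'a octonion))"
    unfolding oct_orbit_left_mult_image_n0 by (auto simp: oct8_simps intro!: exI[of _ "oct_v0"])
  ultimately show ?thesis
    using mem_oct_orbit_trans by (simp add: left_mult_image_n0)
qed

text \<open>By \<open>peirce10_parallel\<close>, vanishing products confine
  \<open>A \<inter> U\<close> and \<open>A \<inter> V\<close> to at most a line each; the four cases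
  record which lines are present.\<close>

lemma orbit_small:
  assumes U: "\<And>x y. x \<in> A \<Longrightarrow> x \<in> peirce10 oct_p0 \<Longrightarrow> y \<in> A \<Longrightarrow> y \<in> peirce10 oct_p0 \<Longrightarrow> x * y = 0"
    and V: "\<And>x y. x \<in> A \<Longrightarrow> x \<in> peirce01 oct_p0 \<Longrightarrow> y \<in> A \<Longrightarrow> y \<in> peirce01 oct_p0 \<Longrightarrow> x * y = 0"
  shows "\<exists>I\<in>{{0}, {0, 1}, {1, 3}, {0, 1, 7}}. A \<in> oct_orbit (coord_space I)"
proof -
  have U_line: "\<exists>c. u = oct_scale c x"
    if "x \<in> A" "x \<in> peirce10 oct_p0" "x \<noteq> 0" "u \<in> A" "u \<in> peirce10 oct_p0" for x u
    using peirce10_parallel[OF singular_idempotent_p(1)] U that by metis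
  have V_line: "\<exists>c. u = oct_scale c x"
    if "x \<in> A" "x \<in> peirce01 oct_p0" "x \<noteq> 0" "u \<in> A" "u \<in> peirce01 oct_p0" for x u
    using peirce10_parallel[OF singular_idempotent_p(2), unfolded peirce_p1] V that by metis
  have orbitI: "A \<in> oct_orbit (coord_space I)"
    if f: "f \<in> oct_Aut" and mem: "f ` oct_unit ` I \<subseteq> A"
      and sub: "\<And>u v a. u \<in> A \<Longrightarrow> u \<in> peirce10 oct_p0 \<Longrightarrow> v \<in> A \<Longrightarrow> v \<in> peirce01 oct_p0 \<Longrightarrow>
        oct_scale a oct_p0 + u + v \<in> f ` coord_space I" for f I
  proof (rule mem_oct_orbit_vimage[OF f])
    show "f -` A = coord_space I"
    proof
      show "coord_space I \<subseteq> f -` A"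
        using ts_subalgebraD(1)[OF ts_subalgebra_vimage[OF f ts]] mem
        by (intro coord_space_subset) auto
      show "f -` A \<subseteq> coord_space I"
      proof
        fix z assume "z \<in> f -` A"
        then obtain a u v where "u \<in> A" "u \<in> peirce10 oct_p0" "v \<in> A" "v \<in> peirce01 oct_p0"
          "f z = oct_scale a oct_p0 + u + v"
          using decompose[of "f z"] by (metis vimageE)
        then have "f z \<in> f ` coord_space I"
          using sub by simp
        then show "z \<in> coord_space I"
          by (simp add: image_iff oct_Aut_inj[OF f])
      qed
    qed
  qed
  consider (a) "\<And>u. u \<in> A \<Longrightarrow> u \<in> peirce10 oct_p0 \<Longrightarrow> u = 0" "\<And>v. v \<in> A \<Longrightarrow> v \<in> peirce01 oct_p0 \<Longrightarrow> v = 0"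
    | (b) x where "x \<in> A" "x \<in> peirce10 oct_p0" "x \<noteq> 0" "\<And>v. v \<in> A \<Longrightarrow> v \<in> peirce01 oct_p0 \<Longrightarrow> v = 0"
    | (c) y where "y \<in> A" "y \<in> peirce01 oct_p0" "y \<noteq> 0" "\<And>u. u \<in> A \<Longrightarrow> u \<in> peirce10 oct_p0 \<Longrightarrow> u = 0"
    | (d) x y where "x \<in> A" "x \<in> peirce10 oct_p0" "x \<noteq> 0" "y \<in> A" "y \<in> peirce01 oct_p0" "y \<noteq> 0"
    by metis
  then show ?thesis
  proof cases
    case a
    have "A \<in> oct_orbit (coord_space {0})"
    proof (rule orbitI[OF oct_Aut_id])
      show "id ` oct_unit ` {0} \<subseteq> A"
        using p0 by (simp add: oct_unit_simps oct8_p0)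
      show "oct_scale k oct_p0 + u + v \<in> id ` coord_space {0}"
        if "u \<in> A" "u \<in> peirce10 oct_p0" "v \<in> A" "v \<in> peirce01 oct_p0" for u v k
      proof -
        have "u = 0" "v = 0"
          using a that by auto
        then show ?thesis
          by (simp add: oct8_p0 oct8_scale mem_coord_space)
      qed
    qed
    then show ?thesis by blast
  next
    case b
    obtain f where f: "f \<in> oct_Aut" "f oct_p0 = oct_p0" "f oct_n0 = x"
      using oct_Aut_transitive_peirce10[OF singular_idempotent_p(1) b(2,3)] by blast
    have "A \<in> oct_orbit (coord_space {0, 1})"
    proof (rule orbitI[OF f(1)])
      show "f ` oct_unit ` {0, 1} \<subseteq> A"
        using p0 b(1) f(2,3) by (simp add: oct_unit_simps oct8_p0 oct8_n0)
      show "oct_scale k oct_p0 + u + v \<in> f ` coord_space {0, 1}"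
        if uv: "u \<in> A" "u \<in> peirce10 oct_p0" "v \<in> A" "v \<in> peirce01 oct_p0" for u v k
      proof -
        obtain c where "u = oct_scale c x" "v = 0"
          using U_line[OF b(1-3) uv(1,2)] b(4) uv by blast
        then have "oct_scale k oct_p0 + u + v = f (oct_scale k oct_p0 + oct_scale c oct_n0)"
          by (simp add: oct_AutD[OF f(1)] f(2,3))
        moreover have "oct_scale k oct_p0 + oct_scale c oct_n0 \<in> coord_space {0, 1}"
          by (simp add: oct8_simps mem_coord_space)
        ultimately show ?thesis by blast
      qed
    qed
    then show ?thesis by blast
  next
    case c
    \<comment> \<open>The idempotents are exchanged because \<open>y\<close> lies in the U of
      \<open>oct_p1\<close>. Thus \<open>oct_p0\<close> becomes the image of unit 3, whence the
      indices 1 and 3.\<close>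
    obtain f where f: "f \<in> oct_Aut" "f oct_p0 = oct_p1" "f oct_n0 = y"
      using oct_Aut_transitive_peirce10[OF singular_idempotent_p(2), unfolded peirce_p1, OF c(2,3)] by blast
    have p1: "f oct_p1 = oct_p0"
      by (simp add: oct_Aut_p1[OF f(1)] f(2)) (simp add: oct8_simps)
    have "A \<in> oct_orbit (coord_space {1, 3})"
    proof (rule orbitI[OF f(1)])
      show "f ` oct_unit ` {1, 3} \<subseteq> A"
        using p0 c(1) f(3) p1 by (simp add: oct_unit_simps oct8_n0)
      show "oct_scale k oct_p0 + u + v \<in> f ` coord_space {1, 3}"
        if uv: "u \<in> A" "u \<in> peirce10 oct_p0" "v \<in> A" "v \<in> peirce01 oct_p0" for u v k
      proof -
        obtain l where "v = oct_scale l y" "u = 0"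
          using V_line[OF c(1-3) uv(3,4)] c(4) uv by blast
        then have "oct_scale k oct_p0 + u + v = f (oct_scale k oct_p1 + oct_scale l oct_n0)"
          by (simp add: oct_AutD[OF f(1)] f(3) p1)
        moreover have "oct_scale k oct_p1 + oct_scale l oct_n0 \<in> coord_space {1, 3}"
          by (simp add: oct8_simps mem_coord_space)
        ultimately show ?thesis by blast
      qed
    qed
    then show ?thesis by blast
  next
    case d
    obtain f where f: "f \<in> oct_Aut" "f oct_p0 = oct_p0" "f oct_n0 = x" "f oct_v0 = y"
      using oct_Aut_transitive_peirce[OF singular_idempotent_p(1) d(2,3,5,6)] closed(4) d(1,4) by blast
    have "A \<in> oct_orbit (coord_space {0, 1, 7})"
    proof (rule orbitI[OF f(1)])
      show "f ` oct_unit ` {0, 1, 7} \<subseteq> A"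
        using p0 d(1,4) f(2-) by (simp add: oct_unit_simps oct8_p0 oct8_n0)
      show "oct_scale k oct_p0 + u + v \<in> f ` coord_space {0, 1, 7}"
        if uv: "u \<in> A" "u \<in> peirce10 oct_p0" "v \<in> A" "v \<in> peirce01 oct_p0" for u v k
      proof -
        obtain c l where "u = oct_scale c x" "v = oct_scale l y"
          using U_line[OF d(1-3) uv(1,2)] V_line[OF d(4-6) uv(3,4)] by blast
        then have "oct_scale k oct_p0 + u + v
            = f (oct_scale k oct_p0 + oct_scale c oct_n0 + oct_scale l oct_v0)"
          by (simp add: oct_AutD[OF f(1)] f(2-))
        moreover have "oct_scale k oct_p0 + oct_scale c oct_n0 + oct_scale l oct_v0 \<in> coord_space {0, 1, 7}"
          by (simp add: oct8_simps mem_coord_space)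
        ultimately show ?thesis by blast
      qed
    qed
    then show ?thesis by blast
  qed
qed

lemma classification: "\<exists>X\<in>ts_normal_forms. A \<in> oct_orbit X"
proof -
  have "\<exists>I\<in>{{0}, {0, 1}, {1, 3}, {0, 1, 7}, {0, 1, 5, 7}, {1, 3, 5, 7}}. A \<in> oct_orbit (coord_space I)"
  proof (rule ccontr)
    assume *: "\<not> ?thesis"
    then have "A \<notin> oct_orbit (coord_space {0, 1, 5, 7})" "A \<notin> oct_orbit (coord_space {1, 3, 5, 7})"
      by simp_all
    then have "\<exists>I\<in>{{0}, {0, 1}, {1, 3}, {0, 1, 7}}. A \<in> oct_orbit (coord_space I)"
      using orbit_right_mult_image orbit_left_mult_image orbit_small by metis
    with * show False by auto
  qed
  then obtain I where I: "I \<in> {{0}, {0, 1}, {1, 3}, {0, 1, 7}, {0, 1, 5, 7}, {1, 3, 5, 7}}" "A \<in> oct_orbit (coord_space I)"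
    by (elim bexE)
  from I(1) have "I \<in> normal_indices"
    unfolding normal_indices_def by (elim insertE emptyE) simp_all
  with I(2) show ?thesis
    unfolding ts_normal_forms_def by (intro bexI[OF _ imageI])
qed

end

theorem ts_subalgebra_classification:
  assumes "ts_subalgebra A"
  shows "\<exists>X\<in>ts_normal_forms. A \<in> oct_orbit X"
proof (cases "\<forall>x\<in>A. oct_trace x = 0")
  case True
  with assms show ?thesis
    by (intro nil_ts_subalgebra.classification nil_ts_subalgebra.intro) auto
next
  case False
  then obtain x where x: "x \<in> A" "oct_trace x \<noteq> 0" by blast
  define e where "e = oct_scale (inverse (oct_trace x)) x"
  have e: "e \<in> A"
    using x(1) ts_subalgebraD(1)[OF assms] by (simp add: e_def oct.subspace_scale)
  then have "singular_idempotent e"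
    using x ts_subalgebraD(3)[OF assms] by (simp add: singular_idempotent_def) (simp add: e_def oct_polar_bilinear(2))
  then obtain f where f: "f \<in> oct_Aut" "f oct_p0 = e"
    using oct_Aut_transitive_idempotent by blast
  have "\<exists>X\<in>ts_normal_forms. f -` A \<in> oct_orbit X"
    using ts_subalgebra_vimage[OF f(1) assms] e f(2)
    by (intro p0_ts_subalgebra.classification p0_ts_subalgebra.intro) auto
  moreover have "A \<in> oct_orbit (f -` A)"
    using f(1) by (rule mem_oct_orbit_vimage) simp
  ultimately show ?thesis
    using mem_oct_orbit_trans by blast
qed


section \<open>Invariants of the normal forms\<close>

interpretation octp: finite_dimensional_vector_space_pair_1 oct_scale "oct_unit ` {..<8}" oct_scale
  by unfold_locales

lemma algebra_isoD:
  assumes "algebra_iso oct_scale A oct_scale B f"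
  shows "bij_betw f A B" "inj_on f A" "B = f ` A"
    "\<And>x y. x \<in> A \<Longrightarrow> y \<in> A \<Longrightarrow> f (x + y) = f x + f y"
    "\<And>c x. x \<in> A \<Longrightarrow> f (oct_scale c x) = oct_scale c (f x)"
    "\<And>x y. x \<in> A \<Longrightarrow> y \<in> A \<Longrightarrow> f (x * y) = f x * f y"
  using assms by (auto simp: algebra_iso_def bij_betw_def)

text \<open>The notion \<open>algebra_iso\<close> constrains \<open>f\<close> on \<open>A\<close>
  only, so the dimension is transferred by a linear map of the whole space that agrees with
  \<open>f\<close> on a basis of \<open>A\<close>, hence on \<open>A\<close>.\<close>

lemma algebra_iso_dim:
  assumes A: "oct.subspace A" and f: "algebra_iso oct_scale A oct_scale B f"
  shows "oct.dim B = oct.dim A"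
proof -
  note D = algebra_isoD[OF f]
  obtain b where b: "b \<subseteq> A" "oct.independent b" "A \<subseteq> oct.span b" "card b = oct.dim A"
    using oct.basis_exists[of A] .
  then have span: "oct.span b = A"
    using A by (metis oct.span_minimal subset_antisym)
  obtain g where g: "Vector_Spaces.linear oct_scale oct_scale g" "\<And>x. x \<in> b \<Longrightarrow> g x = f x"
    using octp.linear_independent_extend[OF b(2)] by blast
  interpret g: Vector_Spaces.linear oct_scale oct_scale g by (rule g)
  have "oct.subspace {x \<in> A. g x = f x}"
  proof (rule oct.subspaceI)
    show "0 \<in> {x \<in> A. g x = f x}"
      using D(5)[of 0 0] oct.subspace_0[OF A] by (simp add: g.zero)
  qed (simp_all add: D(4,5) g.add g.scale oct.subspace_add[OF A] oct.subspace_scale[OF A])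
  then have "oct.span b \<subseteq> {x \<in> A. g x = f x}"
    using b(1) g(2) by (intro oct.span_minimal) auto
  then have gf: "g x = f x" if "x \<in> A" for x
    using that by (auto simp: span)
  have "inj_on g (oct.span A)"
    unfolding oct.span_eq_iff[THEN iffD2, OF A] using D(2) gf by (simp add: inj_on_def)
  then have "oct.dim (g ` A) = oct.dim A"
    by (rule octp.dim_image_eq[OF g(1)])
  then show ?thesis
    using gf by (simp add: D(3))
qed

lemma algebra_iso_Aut:
  assumes "f \<in> oct_Aut"
  shows "algebra_iso oct_scale A oct_scale (f ` A) f"
  using oct_AutD[OF assms] unfolding algebra_iso_def
  by (auto simp: bij_betw_def intro: inj_on_subset)

lemma algebra_iso_trans:
  assumes "algebra_iso oct_scale A oct_scale B f" "algebra_iso oct_scale B oct_scale C g"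
  shows "algebra_iso oct_scale A oct_scale C (g \<circ> f)"
  using algebra_isoD[OF assms(1)] algebra_isoD[OF assms(2)]
  by (auto simp: algebra_iso_def intro: bij_betw_trans)

lemma oct_Aut_dim:
  assumes "f \<in> oct_Aut" "oct.subspace A"
  shows "oct.dim (f ` A) = oct.dim A"
  using algebra_iso_dim[OF assms(2) algebra_iso_Aut[OF assms(1)]] .

text \<open>On totally singular subalgebras this says that the trace is not identically zero, as xx
  = T(x)x there. Phrased through the product, it is invariant under isomorphisms.\<close>

definition nonzero_square :: "'a::field octonion set \<Rightarrow> bool" where
  "nonzero_square A \<longleftrightarrow> (\<exists>x\<in>A. x * x \<noteq> 0)"

text \<open>This property separates the algebras \<open>On\<close> from the algebras \<open>nO\<close>.\<close>

definition right_annihilated :: "'a::field octonion set \<Rightarrow> bool" where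
  "right_annihilated A \<longleftrightarrow> (\<exists>v\<in>A. v \<noteq> 0 \<and> (\<forall>a\<in>A. a * v = 0))"

lemma algebra_iso_invariants:
  assumes A: "subalgebra A" and f: "algebra_iso oct_scale A oct_scale B f"
  shows "nonzero_square B = nonzero_square A" "has_left_identity B = has_left_identity A"
    "has_right_identity B = has_right_identity A" "right_annihilated B = right_annihilated A"
    "trivial_mult B = trivial_mult A" "associative_on B = associative_on A"
proof -
  note D = algebra_isoD[OF f]
  have closed: "x * y \<in> A" if "x \<in> A" "y \<in> A" for x y
    using A that by (simp add: subalgebra_def)
  have zero: "0 \<in> A"
    using A oct.subspace_0 by (auto simp: subalgebra_def)
  have eq: "f x = f y \<longleftrightarrow> x = y" if "x \<in> A" "y \<in> A" for x y
    using D(2) that by (auto simp: inj_on_def)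
  have eq0: "f x = 0 \<longleftrightarrow> x = 0" if "x \<in> A" for x
    using eq[OF that zero] D(5)[OF zero, of 0] by simp
  show "nonzero_square B = nonzero_square A" "has_left_identity B = has_left_identity A"
    "has_right_identity B = has_right_identity A" "right_annihilated B = right_annihilated A"
    "trivial_mult B = trivial_mult A" "associative_on B = associative_on A"
    by (simp_all add: nonzero_square_def has_left_identity_def has_right_identity_def
        right_annihilated_def trivial_mult_def associative_on_def D(3) eq eq0 closed flip: D(6))
qed

section \<open>Properties that separate the normal forms\<close>

lemma normal_index_cases:
  assumes "I \<in> normal_indices"
  obtains "I = {}" | "I = {0}" | "I = {1}" | "I = {0, 1}" | "I = {1, 3}" | "I = {1, 7}"
    | "I = {0, 1, 7}" | "I = {1, 5, 7}" | "I = {0, 1, 5, 7}" | "I = {1, 3, 5, 7}"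
  using assms unfolding normal_indices_def by (elim insertE emptyE)

lemma dim_normal_form: "I \<in> normal_indices \<Longrightarrow> oct.dim (coord_space I) = card I"
  by (rule dim_coord_space) (auto elim: normal_index_cases)

lemma ts_normal_form:
  assumes "I \<in> normal_indices"
  shows "ts_subalgebra (coord_space I :: 'a::field octonion set)"
proof (rule ts_subalgebraI)
  show "oct.subspace (coord_space I)"
    by (rule subspace_coord_space)
  show "x * y \<in> coord_space I" if "x \<in> coord_space I" "y \<in> coord_space I" for x y :: "'a octonion"
    by (insert assms that, cases x rule: oct8_cases, cases y rule: oct8_cases,
        elim normal_index_cases; simp add: mem_coord_space oct8_mult)
  show "oct_norm x = 0" if "x \<in> coord_space I" for x :: "'a octonion"
    by (insert assms that, cases x rule: oct8_cases,
        elim normal_index_cases; simp add: mem_coord_space oct8_norm)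
qed

lemma associative_normal_form:
  assumes "I \<in> normal_indices" "card I \<le> 3"
  shows "associative_on (coord_space I :: 'a::field octonion set)"
  unfolding associative_on_def
proof (intro ballI)
  fix x y z :: "'a octonion"
  assume mem: "x \<in> coord_space I" "y \<in> coord_space I" "z \<in> coord_space I"
  show "(x * y) * z = x * (y * z)"
    by (insert assms mem, cases x rule: oct8_cases, cases y rule: oct8_cases, cases z rule: oct8_cases,
        elim normal_index_cases; simp add: mem_coord_space oct8_mult algebra_simps)
qed

lemma not_associative_normal_form:
  "\<not> associative_on (coord_space {0, 1, 5, 7} :: 'a::field octonion set)"
  "\<not> associative_on (coord_space {1, 3, 5, 7} :: 'a::field octonion set)"
proof -
  let ?p = "oct_p0 :: 'a octonion" and ?q = "oct_p1 :: 'a octonion"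
    and ?x = "oct8 0 0 0 0 0 1 0 0 :: 'a octonion" and ?y = "oct_v0 :: 'a octonion"
  \<comment> \<open>The factors \<open>?x\<close> and \<open>?y\<close> lie in V and their product
    \<open>oct_n0\<close> lies in U, so \<open>oct_p0\<close> kills \<open>?x\<close> but fixes the
    product.\<close>
  have "?p \<in> coord_space {0, 1, 5, 7}" "?x \<in> coord_space {0, 1, 5, 7}" "?y \<in> coord_space {0, 1, 5, 7}"
    "(?p * ?x) * ?y \<noteq> ?p * (?x * ?y)"
    by (simp_all add: mem_coord_space oct8_simps)
  then show "\<not> associative_on (coord_space {0, 1, 5, 7} :: 'a octonion set)"
    unfolding associative_on_def by blast
  have "?q \<in> coord_space {1, 3, 5, 7}" "?x \<in> coord_space {1, 3, 5, 7}" "?y \<in> coord_space {1, 3, 5, 7}"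
    "(?x * ?y) * ?q \<noteq> ?x * (?y * ?q)"
    by (simp_all add: mem_coord_space oct8_simps)
  then show "\<not> associative_on (coord_space {1, 3, 5, 7} :: 'a octonion set)"
    unfolding associative_on_def by blast
qed

lemma nonzero_square_normal_form:
  assumes "I \<in> normal_indices"
  shows "nonzero_square (coord_space I :: 'a::field octonion set) \<longleftrightarrow> 0 \<in> I \<or> 3 \<in> I"
proof
  assume "nonzero_square (coord_space I :: 'a octonion set)"
  then obtain x :: "'a octonion" where x: "x \<in> coord_space I" "x * x \<noteq> 0"
    by (auto simp: nonzero_square_def)
  show "0 \<in> I \<or> 3 \<in> I"
    by (insert assms x, cases x rule: oct8_cases,
        elim normal_index_cases; simp add: mem_coord_space oct8_zero oct8_mult)
next
  have "oct_p0 * oct_p0 \<noteq> (0 :: 'a octonion)" "oct_p1 * oct_p1 \<noteq> (0 :: 'a octonion)"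
    by (simp_all add: oct8_simps)
  moreover assume "0 \<in> I \<or> 3 \<in> I"
  then have "(oct_p0 :: 'a octonion) \<in> coord_space I \<or> (oct_p1 :: 'a octonion) \<in> coord_space I"
    by (auto simp: mem_coord_space oct8_p0)
  ultimately show "nonzero_square (coord_space I :: 'a octonion set)"
    unfolding nonzero_square_def by blast
qed

lemma left_identity_normal_form:
  "has_left_identity (coord_space {0, 1} :: 'a::field octonion set)"
  "\<not> has_left_identity (coord_space {1, 3} :: 'a::field octonion set)"
  "\<not> has_left_identity (coord_space {1, 7} :: 'a::field octonion set)"
proof -
  have "oct_p0 * x = x" if "x \<in> coord_space {0, 1}" for x :: "'a octonion"
    using that by (cases x rule: oct8_cases) (simp add: mem_coord_space oct8_simps)
  moreover have "(oct_p0 :: 'a octonion) \<in> coord_space {0, 1}"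
    by (simp add: mem_coord_space oct8_p0)
  ultimately show "has_left_identity (coord_space {0, 1} :: 'a octonion set)"
    unfolding has_left_identity_def by blast
  \<comment> \<open>Coordinate 1 of \<open>e * oct_n0\<close> is coordinate 0 of
    \<open>e\<close>.\<close>
  have "\<not> has_left_identity (coord_space I :: 'a octonion set)" if I: "1 \<in> I" "0 \<notin> I" for I
  proof
    assume "has_left_identity (coord_space I :: 'a octonion set)"
    moreover have "(oct_n0 :: 'a octonion) \<in> coord_space I"
      using I by (simp add: mem_coord_space oct8_n0)
    ultimately obtain e :: "'a octonion" where "e \<in> coord_space I" "e * oct_n0 = oct_n0"
      unfolding has_left_identity_def by blast
    then show False
      using I by (cases e rule: oct8_cases) (simp add: mem_coord_space oct8_n0 oct8_mult)
  qed
  then show "\<not> has_left_identity (coord_space {1, 3} :: 'a octonion set)"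
    "\<not> has_left_identity (coord_space {1, 7} :: 'a octonion set)"
    by simp_all
qed

lemma right_identity_normal_form:
  "\<not> has_right_identity (coord_space {0, 1} :: 'a::field octonion set)"
  "has_right_identity (coord_space {1, 3} :: 'a::field octonion set)"
  "\<not> has_right_identity (coord_space {1, 7} :: 'a::field octonion set)"
proof -
  have "x * oct_p1 = x" if "x \<in> coord_space {1, 3}" for x :: "'a octonion"
    using that by (cases x rule: oct8_cases) (simp add: mem_coord_space oct8_simps)
  moreover have "(oct_p1 :: 'a octonion) \<in> coord_space {1, 3}"
    by (simp add: mem_coord_space)
  ultimately show "has_right_identity (coord_space {1, 3} :: 'a octonion set)"
    unfolding has_right_identity_def by blast
  have "\<not> has_right_identity (coord_space I :: 'a octonion set)" if I: "1 \<in> I" "3 \<notin> I" for I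
  proof
    assume "has_right_identity (coord_space I :: 'a octonion set)"
    moreover have "(oct_n0 :: 'a octonion) \<in> coord_space I"
      using I by (simp add: mem_coord_space oct8_n0)
    ultimately obtain e :: "'a octonion" where "e \<in> coord_space I" "oct_n0 * e = oct_n0"
      unfolding has_right_identity_def by blast
    then show False
      using I by (cases e rule: oct8_cases) (simp add: mem_coord_space oct8_n0 oct8_mult)
  qed
  then show "\<not> has_right_identity (coord_space {0, 1} :: 'a octonion set)"
    "\<not> has_right_identity (coord_space {1, 7} :: 'a octonion set)"
    by simp_all
qed

lemma trivial_mult_normal_form:
  "\<not> trivial_mult (coord_space {0, 1} :: 'a::field octonion set)"
  "\<not> trivial_mult (coord_space {1, 3} :: 'a::field octonion set)"
  "trivial_mult (coord_space {1, 7} :: 'a::field octonion set)"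
proof -
  have "nonzero_square A \<Longrightarrow> \<not> trivial_mult A" for A :: "'a octonion set"
    by (auto simp: nonzero_square_def trivial_mult_def)
  then show "\<not> trivial_mult (coord_space {0, 1} :: 'a octonion set)"
    "\<not> trivial_mult (coord_space {1, 3} :: 'a octonion set)"
    by (simp_all add: nonzero_square_normal_form normal_indices_def)
  show "trivial_mult (coord_space {1, 7} :: 'a octonion set)"
    unfolding trivial_mult_def
  proof (intro ballI)
    fix x y :: "'a octonion" assume "x \<in> coord_space {1, 7}" "y \<in> coord_space {1, 7}"
    then show "x * y = 0"
      by (cases x rule: oct8_cases; cases y rule: oct8_cases)
        (simp add: mem_coord_space oct8_zero oct8_mult)
  qed
qed

lemma right_annihilated_normal_form:
  "\<not> right_annihilated (coord_space {0, 1, 5, 7} :: 'a::field octonion set)"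
  "right_annihilated (coord_space {1, 3, 5, 7} :: 'a::field octonion set)"
proof -
  have "v = 0" if v: "v \<in> coord_space {0, 1, 5, 7}" "\<forall>a\<in>coord_space {0, 1, 5, 7}. a * v = 0"
    for v :: "'a octonion"
  proof -
    \<comment> \<open>The three multipliers detect, in this order, coordinates 0 and 1, coordinate
      5, and coordinate 7 of \<open>v\<close>.\<close>
    have "oct_p0 \<in> coord_space {0, 1, 5, 7}" "oct_v0 \<in> coord_space {0, 1, 5, 7}"
      "oct8 0 0 0 0 0 1 0 0 \<in> coord_space {0, 1, 5, 7}"
      by (simp_all add: mem_coord_space oct8_p0)
    then have "oct_p0 * v = 0" "oct_v0 * v = 0" "oct8 0 0 0 0 0 1 0 0 * v = 0"
      using v(2) by blast+
    then show ?thesis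
      using v(1) by (cases v rule: oct8_cases) (simp add: mem_coord_space oct8_simps)
  qed
  then show "\<not> right_annihilated (coord_space {0, 1, 5, 7} :: 'a octonion set)"
    unfolding right_annihilated_def by blast
  have "a * oct_n0 = 0" if "a \<in> coord_space {1, 3, 5, 7}" for a :: "'a octonion"
    using that by (cases a rule: oct8_cases) (simp add: mem_coord_space oct8_simps)
  moreover have "oct_n0 \<in> coord_space {1, 3, 5, 7}" "oct_n0 \<noteq> (0 :: 'a octonion)"
    by (simp_all add: mem_coord_space oct8_simps)
  ultimately show "right_annihilated (coord_space {1, 3, 5, 7} :: 'a octonion set)"
    unfolding right_annihilated_def by blast
qed

text \<open>Dimension and \<open>nonzero_square\<close> leave two ambiguous pairs: the planes with a
  one-sided identity, separated by \<open>has_left_identity\<close>, and the two forms of dimension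
  4, separated by \<open>right_annihilated\<close>.\<close>

lemma normal_form_unique:
  assumes I: "I \<in> normal_indices" and J: "J \<in> normal_indices"
    and iso: "isomorphic_subalgebras (coord_space I :: 'a::field octonion set) (coord_space J)"
  shows "I = J"
proof -
  let ?I = "coord_space I :: 'a octonion set" and ?J = "coord_space J :: 'a octonion set"
  obtain f where f: "algebra_iso oct_scale ?I oct_scale ?J f"
    using iso by (auto simp: isomorphic_subalgebras_def)
  have "subalgebra ?I"
    using ts_normal_form[OF I, where 'a = 'a] by (simp add: ts_subalgebra_def)
  note inv = algebra_iso_invariants[OF this f]
  have card: "card J = card I"
    using algebra_iso_dim[OF subspace_coord_space f] by (simp add: dim_normal_form I J)
  have sq: "0 \<in> J \<or> 3 \<in> J \<longleftrightarrow> 0 \<in> I \<or> 3 \<in> I"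
    using inv(1) by (simp add: nonzero_square_normal_form I J)
  note rules = left_identity_normal_form[where 'a = 'a] right_annihilated_normal_form[where 'a = 'a]
  show ?thesis
    using I J card sq inv(2,4)
    by (elim normal_index_cases; simp add: rules del: One_nat_def)
qed

lemma normal_form_orbit_eq:
  assumes "I \<in> normal_indices" "J \<in> normal_indices"
    and "oct_orbit (coord_space I :: 'a::field octonion set) = oct_orbit (coord_space J)"
  shows "I = J"
proof -
  have "(coord_space J :: 'a octonion set) \<in> oct_orbit (coord_space I)"
    using assms(3) oct_orbit_eq_iff by metis
  then obtain f where "f \<in> oct_Aut" "coord_space J = f ` (coord_space I :: 'a octonion set)"
    by (auto simp: oct_orbit_def)
  then have "isomorphic_subalgebras (coord_space I :: 'a octonion set) (coord_space J)"
    using algebra_iso_Aut unfolding isomorphic_subalgebras_def by metis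
  then show ?thesis
    using normal_form_unique assms(1,2) by blast
qed

section \<open>From normal forms to orbits\<close>

lemma ts_classification_index:
  assumes "ts_subalgebra A"
  obtains I f where "I \<in> normal_indices" "f \<in> oct_Aut" "A = f ` coord_space I" "oct.dim A = card I"
proof -
  obtain I f where I: "I \<in> normal_indices" "f \<in> oct_Aut" "A = f ` coord_space I"
    using ts_subalgebra_classification[OF assms] by (auto simp: ts_normal_forms_def oct_orbit_def)
  moreover have "oct.dim A = card I"
    using I oct_Aut_dim[OF I(2) subspace_coord_space] by (simp add: dim_normal_form)
  ultimately show thesis by (rule that)
qed

lemma ts_subalgebra_image:
  assumes "f \<in> oct_Aut" "ts_subalgebra A"
  shows "ts_subalgebra (f ` A)"
proof -
  have "inv f -` A = f ` A"
    using bij_vimage_eq_inv_image[OF oct_AutD(1)[OF oct_Aut_inv[OF assms(1)]]]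
      oct_AutD(1)[OF assms(1)] by (simp add: inv_inv_eq)
  then show ?thesis
    using ts_subalgebra_vimage[OF oct_Aut_inv[OF assms(1)] assms(2)] by simp
qed

lemma mem_ts_subalgebras: "A \<in> ts_subalgebras d \<longleftrightarrow> ts_subalgebra A \<and> oct.dim A = d"
  by (auto simp: ts_subalgebras_def ts_subalgebra_def)

lemma image_mem_ts_subalgebras:
  assumes "f \<in> oct_Aut" "A \<in> ts_subalgebras d"
  shows "f ` A \<in> ts_subalgebras d"
  using assms ts_subalgebra_image[OF assms(1)] oct_Aut_dim[OF assms(1) ts_subalgebraD(1)]
  by (simp add: mem_ts_subalgebras)

lemma orbits_ts_subalgebras:
  "oct_orbits (ts_subalgebras d :: 'a::field octonion set set) =
    (\<lambda>I. oct_orbit (coord_space I)) ` {I \<in> normal_indices. card I = d}"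
proof (intro equalityI subsetI)
  fix X assume "X \<in> oct_orbits (ts_subalgebras d :: 'a octonion set set)"
  then obtain A :: "'a octonion set" where A: "ts_subalgebra A" "oct.dim A = d" "X = oct_orbit A"
    by (auto simp: oct_orbits_def mem_ts_subalgebras)
  obtain I f where I: "I \<in> normal_indices" "f \<in> oct_Aut" "A = f ` coord_space I" "oct.dim A = card I"
    using ts_classification_index[OF A(1)] .
  then have "oct_orbit A = oct_orbit (coord_space I)"
    unfolding oct_orbit_eq_iff by (auto simp: oct_orbit_def)
  with A I show "X \<in> (\<lambda>I. oct_orbit (coord_space I)) ` {I \<in> normal_indices. card I = d}"
    by auto
next
  fix X :: "'a octonion set set"
  assume "X \<in> (\<lambda>I. oct_orbit (coord_space I)) ` {I \<in> normal_indices. card I = d}"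
  then show "X \<in> oct_orbits (ts_subalgebras d)"
    by (auto simp: oct_orbits_def mem_ts_subalgebras ts_normal_form dim_normal_form)
qed

text \<open>Matches intrinsic descriptions with orbits: an invariant property satisfied by exactly
  one normal form of its dimension cuts out the orbit of that form.\<close>

lemma class_eq_orbit:
  fixes P :: "'a::field octonion set \<Rightarrow> bool"
  assumes inv: "\<And>f A. f \<in> oct_Aut \<Longrightarrow> ts_subalgebra A \<Longrightarrow> P A \<Longrightarrow> P (f ` A)"
    and I: "I \<in> normal_indices" "card I = d" "P (coord_space I)"
    and unique: "\<And>J. J \<in> normal_indices \<Longrightarrow> card J = d \<Longrightarrow> P (coord_space J) \<Longrightarrow> J = I"
  shows "{A \<in> ts_subalgebras d. P A} = oct_orbit (coord_space I)"
proof (intro equalityI subsetI)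
  fix A :: "'a octonion set" assume A: "A \<in> {A \<in> ts_subalgebras d. P A}"
  obtain J f where J: "J \<in> normal_indices" "f \<in> oct_Aut" "A = f ` coord_space J" "oct.dim A = card J"
    using A ts_classification_index[of A] by (auto simp: mem_ts_subalgebras)
  have "coord_space J = inv f ` A"
    using J(3) oct_AutD(1)[OF J(2)] by (simp add: bij_is_inj image_inv_f_f)
  then have "P (coord_space J)"
    using A inv[OF oct_Aut_inv[OF J(2)]] by (auto simp: mem_ts_subalgebras)
  then have "J = I"
    using unique J A by (auto simp: mem_ts_subalgebras)
  with J show "A \<in> oct_orbit (coord_space I)"
    by (auto simp: oct_orbit_def)
next
  fix A :: "'a octonion set" assume "A \<in> oct_orbit (coord_space I)"
  then obtain f where f: "f \<in> oct_Aut" "A = f ` coord_space I"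
    by (auto simp: oct_orbit_def)
  moreover have "coord_space I \<in> (ts_subalgebras d :: 'a octonion set set)"
    using I by (simp add: mem_ts_subalgebras ts_normal_form dim_normal_form)
  ultimately show "A \<in> {A \<in> ts_subalgebras d. P A}"
    using inv I(3) ts_normal_form[OF I(1)] image_mem_ts_subalgebras by auto
qed

lemma normal_indices_card:
  "{I \<in> normal_indices. card I = 1} = {{0}, {1}}"
  "{I \<in> normal_indices. card I = 2} = {{0, 1}, {1, 3}, {1, 7}}"
  "{I \<in> normal_indices. card I = 3} = {{1, 5, 7}, {0, 1, 7}}"
  "{I \<in> normal_indices. card I = 4} = {{0, 1, 5, 7}, {1, 3, 5, 7}}"
proof -
  have insert: "{x \<in> insert a S. P x} = (if P a then insert a {x \<in> S. P x} else {x \<in> S. P x})"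
    for a S and P :: "nat set \<Rightarrow> bool"
    by auto
  show "{I \<in> normal_indices. card I = 1} = {{0}, {1}}"
    "{I \<in> normal_indices. card I = 2} = {{0, 1}, {1, 3}, {1, 7}}"
    "{I \<in> normal_indices. card I = 3} = {{1, 5, 7}, {0, 1, 7}}"
    "{I \<in> normal_indices. card I = 4} = {{0, 1, 5, 7}, {1, 3, 5, 7}}"
    unfolding normal_indices_def insert by (simp_all add: insert_commute)
qed

lemma one_perp_image:
  assumes "f \<in> oct_Aut"
  shows "f ` A \<subseteq> one_perp \<longleftrightarrow> A \<subseteq> one_perp"
  by (auto simp: one_perp_def oct_Aut_trace[OF assms])

text \<open>If N(a) is non-zero, the quadratic equation expresses N(a)1 through a and aa, so 1 lies
  in \<open>A\<close>. Conversely N(1) = 1.\<close>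

lemma one_notin_subalgebra:
  assumes "subalgebra A"
  shows "1 \<notin> A \<longleftrightarrow> totally_singular A"
proof
  assume "totally_singular A"
  then show "1 \<notin> A"
    by (auto simp: totally_singular_def oct8_simps dest!: equalityD1)
next
  assume one: "1 \<notin> A"
  have sub: "oct.subspace A"
    using assms by (simp add: subalgebra_def)
  have "oct_norm a = 0" if a: "a \<in> A" for a
  proof (rule ccontr)
    assume N: "oct_norm a \<noteq> 0"
    have "oct_scale (oct_norm a) 1 = oct_scale (oct_trace a) a - a * a"
      by (simp add: oct_square)
    moreover have "oct_scale (oct_trace a) a - a * a \<in> A"
      using assms a by (intro oct.subspace_diff[OF sub] oct.subspace_scale[OF sub]) (auto simp: subalgebra_def)
    ultimately have "oct_scale (inverse (oct_norm a)) (oct_scale (oct_norm a) 1) \<in> A"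
      by (metis oct.subspace_scale sub)
    with N one show False by simp
  qed
  then show "totally_singular A"
    using oct.subspace_0[OF sub] by (force simp: totally_singular_def)
qed


section \<open>The theorem\<close>

lemma coord_space_0: "coord_space {0} = oct.span {oct_p0}"
  and coord_space_1: "coord_space {1} = oct.span {oct_n0}"
  and coord_space_01: "coord_space {0, 1} = oct.span {oct_p0, oct_n0}"
  by (simp_all add: coord_space_def oct_unit_simps oct8_p0 oct8_n0)

lemma oct_Aut_image_span:
  assumes "f \<in> oct_Aut"
  shows "f ` oct.span S = oct.span (f ` S)"
proof -
  interpret f: Vector_Spaces.linear oct_scale oct_scale f
    by (rule oct_Aut_linear[OF assms])
  show ?thesis by (simp add: f.span_image)
qed

lemma oct_Aut_independent:
  assumes "f \<in> oct_Aut" "oct.independent S"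
  shows "oct.independent (f ` S)"
proof -
  interpret f: Vector_Spaces.linear oct_scale oct_scale f
    by (rule oct_Aut_linear[OF assms(1)])
  show ?thesis
    using f.independent_inj_image assms oct_AutD(1)[OF assms(1)] bij_is_inj by blast
qed

section \<open>Dimension one\<close>

lemma ts_lines:
  "ts_subalgebras 1 = {oct.span {a} | a :: 'a::field octonion. a \<noteq> 0 \<and> oct_norm a = 0}"
proof (intro equalityI subsetI)
  fix A :: "'a octonion set" assume "A \<in> ts_subalgebras 1"
  then have A: "ts_subalgebra A" "oct.dim A = 1"
    by (simp_all add: mem_ts_subalgebras)
  obtain I f where I: "I \<in> normal_indices" "f \<in> oct_Aut" "A = f ` coord_space I" "oct.dim A = card I"
    using ts_classification_index[OF A(1)] .
  then have "I \<in> {{0}, {1}}"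
    using A(2) unfolding normal_indices_card(1)[symmetric] by simp
  then have "\<exists>a::'a octonion. coord_space I = oct.span {a} \<and> a \<noteq> 0 \<and> oct_norm a = 0"
  proof (elim insertE emptyE)
    assume "I = {0}"
    then show ?thesis
      by (intro exI[of _ oct_p0]) (simp add: coord_space_0 oct_split)
  next
    assume "I = {1}"
    then show ?thesis
      by (intro exI[of _ oct_n0]) (simp add: coord_space_1[simplified] oct8_simps del: oct.span_singleton)
  qed
  then obtain a :: "'a octonion" where a: "coord_space I = oct.span {a}" "a \<noteq> 0" "oct_norm a = 0"
    by blast
  have "A = oct.span {f a}"
    by (simp add: I(3) a(1) oct_Aut_image_span[OF I(2)])
  moreover have "f a \<noteq> 0" "oct_norm (f a) = 0"
    using a oct_Aut_inj[OF I(2), of a 0] by (simp_all add: oct_Aut_zero[OF I(2)] oct_Aut_norm[OF I(2)])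
  ultimately show "A \<in> {oct.span {a} | a. a \<noteq> 0 \<and> oct_norm a = 0}"
    by blast
next
  fix A :: "'a octonion set" assume "A \<in> {oct.span {a} | a. a \<noteq> 0 \<and> oct_norm a = 0}"
  then obtain a where a: "A = oct.span {a}" "a \<noteq> 0" "oct_norm a = 0"
    by blast
  have "ts_subalgebra A"
  proof (rule ts_subalgebraI)
    show "oct.subspace A"
      by (simp add: a(1))
    have range: "A = range (\<lambda>c. oct_scale c a)"
      by (simp add: a(1) oct.span_singleton)
    have "a * a = oct_scale (oct_trace a) a"
      by (simp add: oct_square a(3))
    then show "x * y \<in> A" if "x \<in> A" "y \<in> A" for x y
      using that by (auto simp: range oct_mult_bilinear)
    show "oct_norm x = 0" if "x \<in> A" for x
      using that by (auto simp: range oct_norm_scale a(3))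
  qed
  moreover have "oct.dim A = 1"
    using a(2) oct.dim_eq_card_independent[of "{a}"] by (simp add: a(1))
  ultimately show "A \<in> ts_subalgebras 1"
    by (simp add: mem_ts_subalgebras)
qed

section \<open>Conjugation and dimension two\<close>

lemma ts_subalgebra_conj:
  assumes "ts_subalgebra A"
  shows "ts_subalgebra (oct_conj ` A)" "oct.dim (oct_conj ` A) = oct.dim A"
proof -
  note closed = ts_subalgebraD[OF assms]
  have lin: "Vector_Spaces.linear oct_scale oct_scale (oct_conj :: 'a octonion \<Rightarrow> _)"
    by unfold_locales (simp_all add: oct_conj_linear)
  have inj: "inj_on oct_conj S" for S :: "'a octonion set"
    by (metis inj_onI oct_conj_conj)
  show "oct.dim (oct_conj ` A) = oct.dim A"
    using lin inj by (rule octp.dim_image_eq)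
  have mem: "oct_conj x \<in> oct_conj ` A \<longleftrightarrow> x \<in> A" for x
    by (metis image_iff oct_conj_conj)
  have mem': "x \<in> oct_conj ` A \<longleftrightarrow> oct_conj x \<in> A" for x
    using mem[of "oct_conj x"] by simp
  show "ts_subalgebra (oct_conj ` A)"
  proof (rule ts_subalgebraI)
    show "oct.subspace (oct_conj ` A)"
      using oct.subspace_0[OF closed(1)] oct.subspace_add[OF closed(1)] oct.subspace_scale[OF closed(1)]
      by (intro oct.subspaceI) (simp_all add: mem' oct_conj_linear)
    show "x * y \<in> oct_conj ` A" if "x \<in> oct_conj ` A" "y \<in> oct_conj ` A" for x y
      using that closed(2) by (simp add: mem' oct_conj_mult)
    show "oct_norm x = 0" if "x \<in> oct_conj ` A" for x
      using that closed(3)[of "oct_conj x"] by (simp add: mem')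
  qed
qed

lemma oct_conj_image_conj [simp]: "oct_conj ` oct_conj ` A = A"
  by (simp add: image_comp comp_def)

lemma right_identity_conj:
  "has_right_identity (oct_conj ` A) \<longleftrightarrow> has_left_identity A"
proof -
  have "oct_conj x * oct_conj e = oct_conj x \<longleftrightarrow> e * x = x" for e x :: "'a octonion"
    by (metis oct_conj_conj oct_conj_mult)
  then show ?thesis
    by (simp add: has_right_identity_def has_left_identity_def)
qed

lemma anti_automorphism_conj: "oct_anti_automorphism oct_conj"
  unfolding oct_anti_automorphism_def
proof (intro conjI allI)
  show "Vector_Spaces.linear oct_scale oct_scale (oct_conj :: 'a octonion \<Rightarrow> _)"
    by unfold_locales (simp_all add: oct_conj_linear)
  show "bij (oct_conj :: 'a octonion \<Rightarrow> _)"
    by (rule o_bij[of oct_conj]) (auto simp: comp_def)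
qed (rule oct_conj_mult)

lemma left_identity_class:
  "{A \<in> ts_subalgebras 2. has_left_identity A} = oct_orbit (coord_space {0, 1} :: 'a::field octonion set)"
proof (rule class_eq_orbit)
  show "has_left_identity (f ` A)" if "f \<in> oct_Aut" "ts_subalgebra A" "has_left_identity A"
    for f and A :: "'a octonion set"
    using that algebra_iso_invariants(2)[OF _ algebra_iso_Aut] by (auto simp: ts_subalgebra_def)
  show "J = {0, 1}" if "J \<in> normal_indices" "card J = 2" "has_left_identity (coord_space J :: 'a octonion set)" for J
  proof -
    have "J \<in> {{0, 1}, {1, 3}, {1, 7}}"
      using that(1,2) unfolding normal_indices_card(2)[symmetric] by blast
    then show ?thesis
      using that(3) left_identity_normal_form[where 'a = 'a] by (elim insertE emptyE) (simp_all only:)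
  qed
qed (simp_all add: left_identity_normal_form[simplified] normal_indices_def)

lemma right_identity_class:
  "{A \<in> ts_subalgebras 2. has_right_identity A} = oct_orbit (coord_space {1, 3} :: 'a::field octonion set)"
proof (rule class_eq_orbit)
  show "has_right_identity (f ` A)" if "f \<in> oct_Aut" "ts_subalgebra A" "has_right_identity A"
    for f and A :: "'a octonion set"
    using that algebra_iso_invariants(3)[OF _ algebra_iso_Aut] by (auto simp: ts_subalgebra_def)
  show "J = {1, 3}" if "J \<in> normal_indices" "card J = 2" "has_right_identity (coord_space J :: 'a octonion set)" for J
  proof -
    have "J \<in> {{0, 1}, {1, 3}, {1, 7}}"
      using that(1,2) unfolding normal_indices_card(2)[symmetric] by blast
    then show ?thesis
      using that(3) right_identity_normal_form[where 'a = 'a] by (elim insertE emptyE) (simp_all only:)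
  qed
qed (simp_all add: right_identity_normal_form[simplified] normal_indices_def)

lemma trivial_mult_class:
  "{A \<in> ts_subalgebras 2. trivial_mult A} = oct_orbit (coord_space {1, 7} :: 'a::field octonion set)"
proof (rule class_eq_orbit)
  show "trivial_mult (f ` A)" if "f \<in> oct_Aut" "ts_subalgebra A" "trivial_mult A"
    for f and A :: "'a octonion set"
    using that algebra_iso_invariants(5)[OF _ algebra_iso_Aut] by (auto simp: ts_subalgebra_def)
  show "J = {1, 7}" if "J \<in> normal_indices" "card J = 2" "trivial_mult (coord_space J :: 'a octonion set)" for J
  proof -
    have "J \<in> {{0, 1}, {1, 3}, {1, 7}}"
      using that(1,2) unfolding normal_indices_card(2)[symmetric] by blast
    then show ?thesis
      using that(3) trivial_mult_normal_form[where 'a = 'a] by (elim insertE emptyE) (simp_all only:)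
  qed
qed (simp_all add: trivial_mult_normal_form[simplified] normal_indices_def)

lemma trivial_mult_one_perp:
  assumes "trivial_mult A"
  shows "A \<subseteq> one_perp"
  using assms oct_nilpotent(2) by (auto simp: trivial_mult_def one_perp_def)

text \<open>Index 0 contributes \<open>oct_p0\<close> and index 3 contributes \<open>oct_p1\<close>;
  both have trace 1, and automorphisms preserve the trace.\<close>

lemma orbit_not_one_perp:
  fixes A :: "'a::field octonion set"
  assumes "A \<in> oct_orbit (coord_space I)" "0 \<in> I \<or> 3 \<in> I"
  shows "\<not> A \<subseteq> one_perp"
proof -
  have "oct_p0 \<notin> (one_perp :: 'a octonion set)" "oct_p1 \<notin> (one_perp :: 'a octonion set)"
    by (simp_all add: one_perp_def oct8_simps)
  moreover have "(oct_p0 :: 'a octonion) \<in> coord_space I \<or> (oct_p1 :: 'a octonion) \<in> coord_space I"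
    using assms(2) by (auto simp: mem_coord_space oct8_p0)
  ultimately have "\<not> coord_space I \<subseteq> (one_perp :: 'a octonion set)"
    by blast
  then show ?thesis
    using assms(1) one_perp_image by (auto simp: oct_orbit_def)
qed

section \<open>Dimension three\<close>

lemma heisenberg_basis_image:
  assumes f: "f \<in> oct_Aut" and b: "heisenberg_basis A x y n"
  shows "heisenberg_basis (f ` A) (f x) (f y) (f n)"
proof -
  have "f (- n) = - f n"
    using oct_AutD(2)[OF f, of "- n" n] by (simp add: oct_Aut_zero[OF f] eq_neg_iff_add_eq_0)
  then show ?thesis
    using b oct_Aut_independent[OF f, of "{x, y, n}"] oct_Aut_image_span[OF f, of "{x, y, n}"]
    by (auto simp: heisenberg_basis_def oct_Aut_inj[OF f] oct_Aut_zero[OF f] simp flip: oct_AutD(4)[OF f])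
qed

lemma heisenberg_basis_normal_form:
  "heisenberg_basis (coord_space {1, 5, 7}) (oct8 0 0 0 0 0 1 0 0) oct_v0 oct_n0"
proof -
  have units: "{oct8 0 0 0 0 0 1 0 0, oct_v0, oct_n0} = oct_unit ` {5, 7, 1 :: nat}"
    by (simp add: oct_unit_simps oct8_n0)
  have "oct.independent {oct8 0 0 0 0 0 1 0 0, oct_v0, oct_n0}"
    unfolding units using independent_oct_unit by (rule oct.independent_mono) auto
  moreover have "oct.span {oct8 0 0 0 0 0 1 0 0, oct_v0, oct_n0} = coord_space {1, 5, 7}"
    unfolding units coord_space_def by (simp add: insert_commute)
  ultimately show ?thesis
    by (simp add: heisenberg_basis_def oct8_simps)
qed

lemma heisenberg_one_perp:
  assumes "heisenberg A"
  shows "A \<subseteq> one_perp"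
proof -
  obtain x y n where b: "heisenberg_basis A x y n"
    using assms by (auto simp: heisenberg_def)
  have "oct.subspace (one_perp :: 'a octonion set)"
    by (auto intro!: oct.subspaceI simp: one_perp_def oct_polar_simps)
  moreover have "{x, y, n} \<subseteq> one_perp"
    using b oct_nilpotent(2) by (auto simp: heisenberg_basis_def one_perp_def)
  ultimately have "oct.span {x, y, n} \<subseteq> one_perp"
    by (rule oct.span_minimal[rotated])
  with b show ?thesis
    by (simp add: heisenberg_basis_def)
qed

lemma heisenberg_class:
  "{A \<in> ts_subalgebras 3. heisenberg A} = oct_orbit (coord_space {1, 5, 7} :: 'a::field octonion set)"
proof (rule class_eq_orbit)
  show "heisenberg (f ` A)" if "f \<in> oct_Aut" "ts_subalgebra A" "heisenberg A"
    for f and A :: "'a octonion set"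
    using that heisenberg_basis_image unfolding heisenberg_def by blast
  show "heisenberg (coord_space {1, 5, 7} :: 'a octonion set)"
    using heisenberg_basis_normal_form unfolding heisenberg_def by blast
  show "J = {1, 5, 7}" if "J \<in> normal_indices" "card J = 3" "heisenberg (coord_space J :: 'a octonion set)" for J
  proof -
    have "J \<in> {{1, 5, 7}, {0, 1, 7}}"
      using that(1,2) unfolding normal_indices_card(3)[symmetric] by blast
    \<comment> \<open>A Heisenberg algebra is traceless, whereas index 0 would contribute an element
      of trace 1.\<close>
    moreover have "0 \<notin> J"
      using orbit_not_one_perp[OF mem_oct_orbit_refl] heisenberg_one_perp[OF that(3)] by blast
    ultimately show ?thesis
      by auto
  qed
qed (simp_all add: normal_indices_def)

lemma image_mult_images:
  assumes "f \<in> oct_Aut"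
  shows "f ` (left_mult_image m \<inter> right_mult_image n) = left_mult_image (f m) \<inter> right_mult_image (f n)"
  by (simp add: image_Int bij_is_inj oct_AutD(1)[OF assms] oct_Aut_mult_image[OF assms])

lemma coord_space_157:
    "coord_space {1, 5, 7} = left_mult_image (oct_n0 :: 'a::field octonion) \<inter> right_mult_image oct_n0"
  and coord_space_017:
    "coord_space {0, 1, 7} = left_mult_image (oct_n0 :: 'a::field octonion) \<inter> right_mult_image oct_v0"
proof -
  have "u \<in> coord_space {1, 5, 7} \<longleftrightarrow> u \<in> coord_space {0, 1, 5, 7} \<and> u \<in> coord_space {1, 3, 5, 7}"
    "u \<in> coord_space {0, 1, 7} \<longleftrightarrow> u \<in> coord_space {0, 1, 5, 7} \<and> u \<in> coord_space {0, 1, 6, 7}"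
    for u :: "'a octonion"
    by (cases u rule: oct8_cases; auto simp: mem_coord_space)+
  then show "coord_space {1, 5, 7} = left_mult_image (oct_n0 :: 'a octonion) \<inter> right_mult_image oct_n0"
    "coord_space {0, 1, 7} = left_mult_image (oct_n0 :: 'a octonion) \<inter> right_mult_image oct_v0"
    unfolding left_mult_image_n0 right_mult_image_n0 right_mult_image_v0 by blast+
qed

lemma heisenberg_orbit:
  "oct_orbit (coord_space {1, 5, 7}) =
    {left_mult_image n \<inter> right_mult_image n | n :: 'a::field octonion. n * n = 0 \<and> n \<noteq> 0}"
proof -
  have "oct_orbit (coord_space {1, 5, 7}) =
    {left_mult_image (f oct_n0) \<inter> right_mult_image (f oct_n0) | f :: 'a octonion \<Rightarrow> _. f \<in> oct_Aut}"
    unfolding oct_orbit_def coord_space_157 by (auto simp: image_mult_images)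
  also have "\<dots> = {left_mult_image n \<inter> right_mult_image n | n :: 'a octonion. n * n = 0 \<and> n \<noteq> 0}"
    using oct_Aut_n0 oct_Aut_transitive_nilpotent by blast
  finally show ?thesis .
qed

text \<open>The automorphism taking \<open>oct_n0\<close> to \<open>n\<close> carries the standard
  basis along, so the given \<open>n\<close> itself becomes the central basis vector.\<close>

lemma heisenberg_basis_nilpotent:
  assumes "n * n = 0" "n \<noteq> 0"
  shows "\<exists>x y. heisenberg_basis (left_mult_image n \<inter> right_mult_image n) x y n"
proof -
  obtain f where f: "f \<in> oct_Aut" "f oct_n0 = n"
    using oct_Aut_transitive_nilpotent[OF assms] by blast
  show ?thesis
    using heisenberg_basis_image[OF f(1) heisenberg_basis_normal_form]
    unfolding coord_space_157 image_mult_images[OF f(1)] f(2) by blast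
qed

text \<open>The standard pair \<open>oct_n0\<close>, \<open>oct_v0\<close> gives the coordinate
  space, and transitivity on independent pairs with vanishing products reaches every other
  pair.\<close>

lemma mixed_orbit:
  "oct_orbit (coord_space {0, 1, 7}) =
    {left_mult_image m \<inter> right_mult_image n | m n :: 'a::field octonion. m \<noteq> n \<and> oct.independent {m, n} \<and>
      m * m = 0 \<and> n * n = 0 \<and> m * n = 0 \<and> n * m = 0}"
proof (intro equalityI subsetI)
  fix A :: "'a octonion set" assume "A \<in> oct_orbit (coord_space {0, 1, 7})"
  then obtain f where f: "f \<in> oct_Aut" "A = left_mult_image (f oct_n0) \<inter> right_mult_image (f oct_v0)"
    unfolding oct_orbit_def coord_space_017 by (auto simp: image_mult_images)
  have "oct_n0 * oct_n0 = (0 :: 'a octonion)" "oct_v0 * oct_v0 = (0 :: 'a octonion)"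
    "oct_n0 * oct_v0 = (0 :: 'a octonion)" "oct_v0 * oct_n0 = (0 :: 'a octonion)"
    "oct_n0 \<noteq> (oct_v0 :: 'a octonion)"
    by (simp_all add: oct8_simps)
  then have "f oct_n0 * f oct_n0 = 0" "f oct_v0 * f oct_v0 = 0" "f oct_n0 * f oct_v0 = 0"
    "f oct_v0 * f oct_n0 = 0" "f oct_n0 \<noteq> f oct_v0"
    by (simp_all add: oct_Aut_zero[OF f(1)] oct_Aut_inj[OF f(1)] flip: oct_AutD(4)[OF f(1)])
  moreover have "oct.independent (f ` oct_unit ` {1, 7})"
    by (intro oct_Aut_independent[OF f(1)] oct.independent_mono[OF independent_oct_unit] image_mono) simp
  then have "oct.independent {f oct_n0, f oct_v0}"
    by (simp add: oct_unit_simps oct8_n0)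
  ultimately show "A \<in> {left_mult_image m \<inter> right_mult_image n | m n. m \<noteq> n \<and> oct.independent {m, n} \<and>
      m * m = 0 \<and> n * n = 0 \<and> m * n = 0 \<and> n * m = 0}"
    using f(2) by blast
next
  fix A :: "'a octonion set"
  assume "A \<in> {left_mult_image m \<inter> right_mult_image n | m n. m \<noteq> n \<and> oct.independent {m, n} \<and>
      m * m = 0 \<and> n * n = 0 \<and> m * n = 0 \<and> n * m = 0}"
  then obtain m n where A: "A = left_mult_image m \<inter> right_mult_image n"
    and mn: "m \<noteq> n" "oct.independent {m, n}" "m * m = 0" "n * n = 0" "m * n = 0" "n * m = 0"
    by blast
  have "m \<noteq> 0"
    using mn(2) oct.dependent_zero by blast
  have "oct.independent (insert n {m})"
    using mn(2) by (simp add: insert_commute)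
  then have "n \<notin> oct.span {m}"
    using mn(1) by (simp add: oct.independent_insert del: oct.span_singleton)
  then have "n \<noteq> oct_scale c m" for c
    by (auto simp: oct.span_singleton)
  then obtain f where f: "f \<in> oct_Aut" "f oct_n0 = m" "f oct_v0 = n"
    using oct_Aut_transitive_null_pair[OF mn(3-6) \<open>m \<noteq> 0\<close>] by blast
  have "A = f ` coord_space {0, 1, 7}"
    unfolding coord_space_017 image_mult_images[OF f(1)] f(2,3) A ..
  with f(1) show "A \<in> oct_orbit (coord_space {0, 1, 7})"
    by (auto simp: oct_orbit_def)
qed

lemma normal_orbits_distinct:
  assumes "I \<in> normal_indices" "J \<in> normal_indices" "I \<noteq> J"
  shows "oct_orbit (coord_space I :: 'a::field octonion set) \<noteq> oct_orbit (coord_space J)"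
  using normal_form_orbit_eq assms by blast

lemma dim_two_classification:
  "let S = ts_subalgebras 2 :: 'f::field octonion set set;
        L = {A \<in> S. has_left_identity A};
        R = {A \<in> S. has_right_identity A};
        Z = {A \<in> S. trivial_mult A} in
      oct_orbits S = {L, R, Z} \<and> distinct [L, R, Z] \<and>
      oct.span {oct_p0, oct_n0} \<in> L \<and>
      oct_anti_automorphism (oct_conj :: 'f octonion \<Rightarrow> 'f octonion) \<and>
      R = (\<lambda>A. oct_conj ` A) ` L \<and>
      (\<lambda>a. a * oct_w) ` oct.span {oct_p0, oct_n0} \<in> Z \<and>
      (\<forall>A\<in>Z. A \<subseteq> one_perp) \<and> (\<forall>A\<in>L \<union> R. \<not> A \<subseteq> one_perp)"
  unfolding Let_def
proof (intro conjI)
  let ?S = "ts_subalgebras 2 :: 'f octonion set set"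
  let ?L = "{A \<in> ?S. has_left_identity A}"
  let ?R = "{A \<in> ?S. has_right_identity A}"
  let ?Z = "{A \<in> ?S. trivial_mult A}"
  have "oct_orbits ?S = {oct_orbit (coord_space {0, 1}), oct_orbit (coord_space {1, 3}), oct_orbit (coord_space {1, 7})}"
    unfolding orbits_ts_subalgebras normal_indices_card by simp
  then show "oct_orbits ?S = {?L, ?R, ?Z}"
    unfolding left_identity_class right_identity_class trivial_mult_class .
  have "{0, 1} \<in> normal_indices" "{1, 3} \<in> normal_indices" "{1, 7} \<in> normal_indices"
    by (simp_all add: normal_indices_def)
  then show "distinct [?L, ?R, ?Z]"
    unfolding left_identity_class right_identity_class trivial_mult_class
    using normal_orbits_distinct[where 'a = 'f] by (simp add: doubleton_eq_iff)
  show "oct.span {oct_p0, oct_n0} \<in> ?L"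
    unfolding left_identity_class coord_space_01[symmetric] by (rule mem_oct_orbit_refl)
  show "oct_anti_automorphism (oct_conj :: 'f octonion \<Rightarrow> 'f octonion)"
    by (rule anti_automorphism_conj)
  \<comment> \<open>Conjugation is an involution, so it exchanges the two classes instead of merely
    mapping one into the other.\<close>
  have R: "oct_conj ` A \<in> ?R \<longleftrightarrow> A \<in> ?L" for A
  proof -
    have "oct_conj ` A \<in> ?S" if "A \<in> ?S" for A
      using that by (simp add: mem_ts_subalgebras ts_subalgebra_conj)
    from this[of A] this[of "oct_conj ` A"] show ?thesis
      by (auto simp: right_identity_conj)
  qed
  show "?R = (\<lambda>A. oct_conj ` A) ` ?L"
  proof (intro equalityI subsetI)
    fix A assume "A \<in> ?R"
    then have "oct_conj ` A \<in> ?L"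
      using R[of "oct_conj ` A"] by simp
    then show "A \<in> (\<lambda>A. oct_conj ` A) ` ?L"
      by (rule rev_image_eqI) simp
  qed (use R in blast)
  \<comment> \<open>Right multiplication by \<open>oct_w\<close> moves a matrix to the second
    component, so indices 0, 1 become 4, 5. This is not one of the normal forms, hence its
    multiplication is checked directly.\<close>
  have "(\<lambda>a. a * oct_w) ` coord_space {0, 1} = (coord_space {4, 5} :: 'f octonion set)"
  proof (intro equalityI subsetI)
    fix u :: "'f octonion" assume "u \<in> coord_space {4, 5}"
    then obtain a b where "u = oct8 0 0 0 0 a b 0 0"
      by (cases u rule: oct8_cases) (auto simp: mem_coord_space)
    then have "u = oct8 a b 0 0 0 0 0 0 * oct_w"
      by (simp add: oct8_simps)
    then show "u \<in> (\<lambda>a. a * oct_w) ` coord_space {0, 1}"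
      by (rule image_eqI) (simp add: mem_coord_space)
  next
    fix u :: "'f octonion" assume "u \<in> (\<lambda>a. a * oct_w) ` coord_space {0, 1}"
    then obtain v where "v \<in> coord_space {0, 1}" "u = v * oct_w"
      by blast
    then show "u \<in> coord_space {4, 5}"
      by (cases v rule: oct8_cases) (simp add: mem_coord_space oct8_w oct8_mult)
  qed
  moreover have "ts_subalgebra (coord_space {4, 5} :: 'f octonion set)" "trivial_mult (coord_space {4, 5} :: 'f octonion set)"
  proof -
    have trivial: "x * y = 0" if "x \<in> coord_space {4, 5}" "y \<in> coord_space {4, 5}" for x y :: "'f octonion"
      by (insert that, cases x rule: oct8_cases, cases y rule: oct8_cases)
        (simp add: mem_coord_space oct8_mult oct8_zero)
    have "oct_norm x = 0" if "x \<in> coord_space {4, 5}" for x :: "'f octonion"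
      by (insert that, cases x rule: oct8_cases) (simp add: mem_coord_space oct8_norm)
    then show "ts_subalgebra (coord_space {4, 5} :: 'f octonion set)"
      using trivial oct.subspace_0[OF subspace_coord_space]
      by (intro ts_subalgebraI subspace_coord_space) simp_all
    show "trivial_mult (coord_space {4, 5} :: 'f octonion set)"
      using trivial unfolding trivial_mult_def by blast
  qed
  ultimately show "(\<lambda>a. a * oct_w) ` oct.span {oct_p0, oct_n0} \<in> ?Z"
    unfolding coord_space_01[symmetric] by (simp add: mem_ts_subalgebras dim_coord_space)
  show "\<forall>A\<in>?Z. A \<subseteq> one_perp"
    using trivial_mult_one_perp by blast
  show "\<forall>A\<in>?L \<union> ?R. \<not> A \<subseteq> one_perp"
    unfolding left_identity_class right_identity_class using orbit_not_one_perp by fast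
qed

text \<open>The isomorphism is not extended to O. It only shows that both subalgebras have the same
  normal form; the automorphism is composed from the two that lead to that form.\<close>

lemma isomorphic_iff_orbit:
  fixes A B :: "'a::field octonion set"
  assumes "ts_subalgebra A" "ts_subalgebra B"
  shows "isomorphic_subalgebras A B \<longleftrightarrow> (\<exists>\<phi>\<in>oct_Aut. \<phi> ` A = B)"
proof
  assume "\<exists>\<phi>\<in>oct_Aut. \<phi> ` A = B"
  then show "isomorphic_subalgebras A B"
    using algebra_iso_Aut unfolding isomorphic_subalgebras_def by blast
next
  assume "isomorphic_subalgebras A B"
  then obtain h where h: "algebra_iso oct_scale A oct_scale B h"
    by (auto simp: isomorphic_subalgebras_def)
  obtain I f where I: "I \<in> normal_indices" "f \<in> oct_Aut" "A = f ` coord_space I"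
    using ts_classification_index[OF assms(1)] .
  obtain J g where J: "J \<in> normal_indices" "g \<in> oct_Aut" "B = g ` coord_space J"
    using ts_classification_index[OF assms(2)] .
  have g: "inv g ` B = coord_space J"
    using J(3) oct_AutD(1)[OF J(2)] by (simp add: bij_is_inj image_inv_f_f)
  have f: "inv f ` A = coord_space I"
    using I(3) oct_AutD(1)[OF I(2)] by (simp add: bij_is_inj image_inv_f_f)
  have "algebra_iso oct_scale (coord_space I) oct_scale (coord_space J) (inv g \<circ> (h \<circ> f))"
    using algebra_iso_trans[OF algebra_iso_trans[OF algebra_iso_Aut[OF I(2), of "coord_space I"] h[unfolded I(3)]]
        algebra_iso_Aut[OF oct_Aut_inv[OF J(2)], of B]] by (simp add: g)
  then have "I = J"
    using normal_form_unique[OF I(1) J(1)] unfolding isomorphic_subalgebras_def by blast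
  then have "(g \<circ> inv f) ` A = B"
    by (simp only: image_comp[symmetric] f J(3))
  then show "\<exists>\<phi>\<in>oct_Aut. \<phi> ` A = B"
    using oct_Aut_comp[OF J(2) oct_Aut_inv[OF I(2)]] by blast
qed

lemma ts_subalgebra_dim_associative:
  fixes A :: "'a::field octonion set"
  assumes "ts_subalgebra A"
  shows "oct.dim A \<le> 4" "oct.dim A \<le> 3 \<Longrightarrow> associative_on A" "oct.dim A = 4 \<Longrightarrow> \<not> associative_on A"
proof -
  obtain I f where I: "I \<in> normal_indices" "f \<in> oct_Aut" "A = f ` coord_space I" "oct.dim A = card I"
    using ts_classification_index[OF assms] .
  have "associative_on A = associative_on (coord_space I :: 'a octonion set)"
    unfolding I(3) using ts_normal_form[OF I(1), where 'a = 'a]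
    by (intro algebra_iso_invariants(6)[OF _ algebra_iso_Aut[OF I(2)]]) (simp add: ts_subalgebra_def)
  moreover have "I \<in> {{0, 1, 5, 7}, {1, 3, 5, 7}}" if "card I = 4"
    using I(1) that unfolding normal_indices_card(4)[symmetric] by blast
  ultimately show "oct.dim A \<le> 3 \<Longrightarrow> associative_on A" "oct.dim A = 4 \<Longrightarrow> \<not> associative_on A"
    using I(4) associative_normal_form[OF I(1), where 'a = 'a] not_associative_normal_form[where 'a = 'a]
    by auto
  show "oct.dim A \<le> 4"
    using I(1) unfolding I(4) by (elim normal_index_cases) simp_all
qed

theorem mainTheorem1:
  shows
  "(\<forall>A :: 'f::field octonion set. subalgebra A \<and> 1 \<notin> A \<longrightarrow>
      totally_singular A \<and> oct.dim A \<le> 4)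
   \<and>
   \<comment> \<open>dimension 1\<close>
   (let S = {A :: 'f octonion set. subalgebra A \<and> 1 \<notin> A \<and> oct.dim A = 1} in
      S = {oct.span {a} | a. a \<noteq> 0 \<and> oct_norm a = 0} \<and>
      oct_orbits S = {oct_orbit (oct.span {oct_p0}), oct_orbit (oct.span {oct_n0})} \<and>
      oct_orbit (oct.span {oct_p0 :: 'f octonion}) \<noteq> oct_orbit (oct.span {oct_n0})) \<and>
   (\<exists>f :: 'f \<Rightarrow> 'f octonion.
      algebra_iso (*) UNIV oct_scale (oct.span {oct_p0}) f \<and> f 1 = oct_p0) \<and>
   oct_p0 \<noteq> (1 :: 'f octonion)
   \<and>
   \<comment> \<open>dimension 2\<close>
   (let S = ts_subalgebras 2 :: 'f octonion set set;
        L = {A \<in> S. has_left_identity A};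
        R = {A \<in> S. has_right_identity A};
        Z = {A \<in> S. trivial_mult A} in
      oct_orbits S = {L, R, Z} \<and> distinct [L, R, Z] \<and>
      oct.span {oct_p0, oct_n0} \<in> L \<and>
      oct_anti_automorphism (oct_conj :: 'f octonion \<Rightarrow> 'f octonion) \<and>
      R = (\<lambda>A. oct_conj ` A) ` L \<and>
      (\<lambda>a. a * oct_w) ` oct.span {oct_p0, oct_n0} \<in> Z \<and>
      (\<forall>A\<in>Z. A \<subseteq> one_perp) \<and> (\<forall>A\<in>L \<union> R. \<not> A \<subseteq> one_perp))
   \<and>
   \<comment> \<open>dimension 3\<close>
   (let S = ts_subalgebras 3 :: 'f octonion set set;
        H = {A \<in> S. heisenberg A};
        M = {left_mult_image m \<inter> right_mult_image n | m n.
               m \<noteq> n \<and> oct.independent {m, n} \<and>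
               m * m = 0 \<and> n * n = 0 \<and> m * n = 0 \<and> n * m = 0} in
      oct_orbits S = {H, M} \<and> H \<noteq> M \<and>
      H = {left_mult_image n \<inter> right_mult_image n | n. n * n = 0 \<and> n \<noteq> 0} \<and>
      (\<forall>n :: 'f octonion. n * n = 0 \<and> n \<noteq> 0 \<longrightarrow>
         (\<exists>x y. heisenberg_basis (left_mult_image n \<inter> right_mult_image n) x y n)) \<and>
      (\<forall>A\<in>H. A \<subseteq> one_perp) \<and> (\<forall>A\<in>M. \<not> A \<subseteq> one_perp))
   \<and>
   \<comment> \<open>dimension 4\<close>
   (let S = ts_subalgebras 4 :: 'f octonion set set;
        P = {left_mult_image n | n. n * n = 0 \<and> n \<noteq> 0};
        Q = {right_mult_image n | n. n * n = 0 \<and> n \<noteq> 0} in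
      oct_orbits S = {P, Q} \<and> P \<noteq> Q)
   \<and>
   (\<forall>A B :: 'f octonion set.
      subalgebra A \<and> totally_singular A \<and> subalgebra B \<and> totally_singular B \<longrightarrow>
      (isomorphic_subalgebras A B \<longleftrightarrow> (\<exists>\<phi>\<in>oct_Aut. \<phi> ` A = B))) \<and>
   (\<forall>A :: 'f octonion set. subalgebra A \<and> totally_singular A \<and> oct.dim A \<le> 3 \<longrightarrow>
      associative_on A) \<and>
   (\<forall>A :: 'f octonion set. subalgebra A \<and> totally_singular A \<and> oct.dim A = 4 \<longrightarrow>
      \<not> associative_on A)"
proof (intro conjI)
  show "\<forall>A :: 'f octonion set. subalgebra A \<and> 1 \<notin> A \<longrightarrow> totally_singular A \<and> oct.dim A \<le> 4"
    using one_notin_subalgebra ts_subalgebra_dim_associative(1) unfolding ts_subalgebra_def by blast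
  \<comment> \<open>Among subalgebras, missing 1 is the same as being totally singular, so the
    classification by normal forms applies.\<close>
  have S: "{A :: 'f octonion set. subalgebra A \<and> 1 \<notin> A \<and> oct.dim A = 1} = ts_subalgebras 1"
    using one_notin_subalgebra by (auto simp: ts_subalgebras_def)
  show "let S = {A :: 'f octonion set. subalgebra A \<and> 1 \<notin> A \<and> oct.dim A = 1} in
      S = {oct.span {a} | a. a \<noteq> 0 \<and> oct_norm a = 0} \<and>
      oct_orbits S = {oct_orbit (oct.span {oct_p0}), oct_orbit (oct.span {oct_n0})} \<and>
      oct_orbit (oct.span {oct_p0 :: 'f octonion}) \<noteq> oct_orbit (oct.span {oct_n0})"
    unfolding Let_def S coord_space_0[symmetric] coord_space_1[symmetric] orbits_ts_subalgebras normal_indices_card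
    using ts_lines normal_orbits_distinct[of "{0}" "{1}"] by (simp add: normal_indices_def)
  show "\<exists>f :: 'f \<Rightarrow> 'f octonion.
      algebra_iso (*) UNIV oct_scale (oct.span {oct_p0}) f \<and> f 1 = oct_p0"
  proof (intro exI conjI)
    show "algebra_iso (*) UNIV oct_scale (oct.span {oct_p0}) (\<lambda>c :: 'f. oct_scale c oct_p0)"
      unfolding algebra_iso_def oct.span_singleton
      by (auto simp: bij_betw_def inj_on_def oct8_simps distrib_right)
  qed simp
  show "oct_p0 \<noteq> (1 :: 'f octonion)"
    by (simp add: oct8_simps)
  show "let S = ts_subalgebras 3 :: 'f octonion set set;
        H = {A \<in> S. heisenberg A};
        M = {left_mult_image m \<inter> right_mult_image n | m n.
               m \<noteq> n \<and> oct.independent {m, n} \<and>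
               m * m = 0 \<and> n * n = 0 \<and> m * n = 0 \<and> n * m = 0} in
      oct_orbits S = {H, M} \<and> H \<noteq> M \<and>
      H = {left_mult_image n \<inter> right_mult_image n | n. n * n = 0 \<and> n \<noteq> 0} \<and>
      (\<forall>n :: 'f octonion. n * n = 0 \<and> n \<noteq> 0 \<longrightarrow>
         (\<exists>x y. heisenberg_basis (left_mult_image n \<inter> right_mult_image n) x y n)) \<and>
      (\<forall>A\<in>H. A \<subseteq> one_perp) \<and> (\<forall>A\<in>M. \<not> A \<subseteq> one_perp)"
    unfolding Let_def
  proof (intro conjI)
    show "oct_orbits (ts_subalgebras 3 :: 'f octonion set set) = {{A \<in> ts_subalgebras 3. heisenberg A},
        {left_mult_image m \<inter> right_mult_image n | m n.
               m \<noteq> n \<and> oct.independent {m, n} \<and>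
               m * m = 0 \<and> n * n = 0 \<and> m * n = 0 \<and> n * m = 0}}"
      unfolding mixed_orbit[symmetric] heisenberg_class orbits_ts_subalgebras normal_indices_card by simp
    show "{A \<in> ts_subalgebras 3. heisenberg A} \<noteq>
        {left_mult_image m \<inter> right_mult_image n | m n :: 'f octonion.
               m \<noteq> n \<and> oct.independent {m, n} \<and>
               m * m = 0 \<and> n * n = 0 \<and> m * n = 0 \<and> n * m = 0}"
      unfolding mixed_orbit[symmetric] heisenberg_class
      by (rule normal_orbits_distinct) (auto simp: normal_indices_def)
    show "{A \<in> ts_subalgebras 3. heisenberg A} =
        {left_mult_image n \<inter> right_mult_image n | n :: 'f octonion. n * n = 0 \<and> n \<noteq> 0}"
      unfolding heisenberg_class by (rule heisenberg_orbit)
    show "\<forall>A\<in>{left_mult_image m \<inter> right_mult_image n | m n :: 'f octonion.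
               m \<noteq> n \<and> oct.independent {m, n} \<and>
               m * m = 0 \<and> n * n = 0 \<and> m * n = 0 \<and> n * m = 0}. \<not> A \<subseteq> one_perp"
      unfolding mixed_orbit[symmetric] using orbit_not_one_perp by fast
  qed (use heisenberg_basis_nilpotent heisenberg_one_perp in blast)+
  show "let S = ts_subalgebras 4 :: 'f octonion set set;
        P = {left_mult_image n | n. n * n = 0 \<and> n \<noteq> 0};
        Q = {right_mult_image n | n. n * n = 0 \<and> n \<noteq> 0} in
      oct_orbits S = {P, Q} \<and> P \<noteq> Q"
    unfolding Let_def orbits_ts_subalgebras normal_indices_card
      oct_orbit_left_mult_image_n0[symmetric] oct_orbit_right_mult_image_n0[symmetric]
      left_mult_image_n0 right_mult_image_n0
  proof
    have "{0, 1, 5, 7} \<noteq> {1 :: nat, 3, 5, 7}"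
      by (metis insertCI insertE numeral_eq_iff zero_neq_numeral zero_neq_one singletonD)
    then show "oct_orbit (coord_space {0, 1, 5, 7} :: 'f octonion set) \<noteq> oct_orbit (coord_space {1, 3, 5, 7})"
      by (intro normal_orbits_distinct) (simp_all add: normal_indices_def)
  qed simp
  show "\<forall>A B :: 'f octonion set.
      subalgebra A \<and> totally_singular A \<and> subalgebra B \<and> totally_singular B \<longrightarrow>
      (isomorphic_subalgebras A B \<longleftrightarrow> (\<exists>\<phi>\<in>oct_Aut. \<phi> ` A = B))"
    using isomorphic_iff_orbit unfolding ts_subalgebra_def by blast
  show "\<forall>A :: 'f octonion set. subalgebra A \<and> totally_singular A \<and> oct.dim A \<le> 3 \<longrightarrow> associative_on A"
    "\<forall>A :: 'f octonion set. subalgebra A \<and> totally_singular A \<and> oct.dim A = 4 \<longrightarrow> \<not> associative_on A"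
    using ts_subalgebra_dim_associative(2,3) unfolding ts_subalgebra_def by blast+
qed (rule dim_two_classification)


end
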